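(* Let $0<s<\frac12$ and $\Lambda\in\mathbb{N}$, $\Lambda\ge1$. Let $X^0\in\mathcal{R}^\Lambda$ and let $T_{\max}$ be the maximal existence time of the solution $t\mapsto X(t)\in\mathcal{R}^\Lambda$ of the Cauchy problem $$\dot X(t)=-\nabla\mathcal{E}^s(X(t)),\qquad X(0)=X^0 .$$ Then $T_{\max}=+\infty$.
   Context: Let $\mathcal{X}^\Lambda:=[0,\Lambda)^\Lambda$; entries of $X=(x_1,\dots,x_\Lambda)\in\mathcal{X}^\Lambda$ need not be distinct. Let $\mathcal{R}^\Lambda$ be the set of regular configurations, i.e. of those $X\in\mathcal{X}^\Lambda$ with pairwise distinct entries. Let $\mu^X:=\sum_{\lambda=1}^{\Lambda}\sum_{k\in\mathbb{Z}}\delta_{x_\lambda+\Lambda k}$, and let $u^X\in BV_{\rm loc}(\mathbb{R})$ be the function, unique up to additive constants and $\Lambda$-periodic, whose distributional derivative is $(u^X)'=\mathrm{d}x-\mu^X$. For $0<s<\frac12$, $$\mathcal{E}^s(X):=\frac12\int_0^\Lambda \mathrm{d}x\int_{\mathbb{R}}\frac{|u^X(x)-u^X(y)|^2}{|x-y|^{1+2s}}\,\mathrm{d}y .$$ Since $\mathcal{E}^s$ depends on $X$ only through $\mu^X$, positions are read modulo $\Lambda$, so that $\mathcal{E}^s$ is a function on the torus $(\mathbb{R}/\Lambda\mathbb{Z})^\Lambda$, smooth on the open set $\mathcal{R}^\Lambda$ of regular configurations. The gradient and the differential equation are understood in this sense: a particle leaving $[0,\Lambda)$ re-enters by periodicity,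 i.e. the equation holds for the continuous lift of the trajectory to $\mathbb{R}^\Lambda$. The problem has a unique $C^1$ solution in $\mathcal{R}^\Lambda$ on a maximal interval $[0,T_{\max})$. *)

theory Defs
  imports "HOL-Analysis.Analysis" "HOL-Library.Real_Mod" "HOL-Library.Extended_Real"
begin

text \<open>
  The number of particles, which is also the length of the period, is the cardinality of the
  index type \<open>'n\<close>; configurations are vectors \<open>X :: real ^ 'n\<close>.
\<close>

definition config_space :: "(real ^ 'n) set" where
  "config_space = {X. \<forall>i. 0 \<le> X $ i \<and> X $ i < real CARD('n)}"

definition regular_configs :: "(real ^ 'n) set" where
  "regular_configs = {X \<in> config_space. inj (\<lambda>i. X $ i)}"

text \<open>
  The sum of the Dirac masses at the points \<open>X $ i + k * CARD('n)\<close>, counted with multiplicity,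
  as the image of the counting measure on the pairs \<open>(i, k)\<close>. It is defined for every
  \<open>X :: real ^ 'n\<close> and only depends on the positions modulo the period.
\<close>

definition config_measure :: "real ^ 'n \<Rightarrow> real measure" where
  "config_measure X =
     distr (count_space UNIV) borel (\<lambda>(i :: 'n, k :: int). X $ i + real CARD('n) * of_int k)"

definition test_fun :: "(real \<Rightarrow> real) \<Rightarrow> bool" where
  "test_fun \<phi> \<longleftrightarrow>
     (\<forall>k x. ((deriv ^^ k) \<phi>) differentiable (at x)) \<and> compact (closure {x. \<phi> x \<noteq> 0})"

text \<open>
  A periodic, locally integrable \<open>u\<close> with distributional derivative \<open>dx - config_measure X\<close>.
  This derivative is a Radon measure, so such a \<open>u\<close> is locally of bounded variation. Only the
  class of \<open>u\<close> modulo null sets is relevant, and it is represented by a Borel function.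
\<close>

definition is_potential :: "real ^ 'n \<Rightarrow> (real \<Rightarrow> real) \<Rightarrow> bool" where
  "is_potential X u \<longleftrightarrow>
     u \<in> borel_measurable borel \<and>
     (\<forall>a b. set_integrable lborel {a..b} u) \<and>
     (\<forall>x. u (x + real CARD('n)) = u x) \<and>
     (\<forall>\<phi>. test_fun \<phi> \<longrightarrow>
        - (LINT x|lborel. u x * deriv \<phi> x) =
          (LINT x|lborel. \<phi> x) - (LINT x|config_measure X. \<phi> x))"

text \<open>
  Potentials are unique up to additive constants (and null sets), on which the energy below
  does not depend.
\<close>

definition potential :: "real ^ 'n \<Rightarrow> real \<Rightarrow> real" where
  "potential X = (SOME u. is_potential X u)"

definition energy :: "real \<Rightarrow> real ^ 'n \<Rightarrow> real" where
  "energy s X =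
     1 / 2 * enn2real (\<integral>\<^sup>+ x \<in> {0..real CARD('n)}.
       (\<integral>\<^sup>+ y. ennreal (\<bar>potential X x - potential X y\<bar>\<^sup>2 / \<bar>x - y\<bar> powr (1 + 2 * s)) \<partial>lborel)
       \<partial>lborel)"

definition wrap :: "real ^ 'n \<Rightarrow> real ^ 'n" where
  "wrap X = (\<chi> i. (X $ i) rmod (real CARD('n)))"

text \<open>
  \<open>X\<close> is a continuously differentiable solution on \<open>[0,T)\<close> of the gradient flow of the energy on
  the torus, starting at \<open>X0\<close>: its values are regular configurations, and it has a lift \<open>Y\<close> to
  \<open>real ^ 'n\<close> which satisfies the equation. The derivative is one-sided at time \<open>0\<close>, and the
  gradient of the energy is required to exist along \<open>Y\<close>.
\<close>

definition flow_solution :: "real \<Rightarrow> real ^ 'n \<Rightarrow> ereal \<Rightarrow> (real \<Rightarrow> real ^ 'n) \<Rightarrow> bool" where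
  "flow_solution s X0 T X \<longleftrightarrow>
     (let I = {t. 0 \<le> t \<and> ereal t < T} in
       X 0 = X0 \<and> (\<forall>t\<in>I. X t \<in> regular_configs) \<and>
       (\<exists>Y G. (\<forall>t\<in>I. X t = wrap (Y t)) \<and> continuous_on I G \<and>
          (\<forall>t\<in>I. GDERIV (energy s) (Y t) :> G t \<and>
                 (Y has_vector_derivative - G t) (at t within I))))"

definition max_existence_time :: "real \<Rightarrow> real ^ 'n \<Rightarrow> ereal" where
  "max_existence_time s X0 = Sup {T. 0 < T \<and> (\<exists>X. flow_solution s X0 T X)}"

end

theory Submission
  imports Defs
begin

text \<open>
  The function \<open>u\<close> is a sum of sawtooth functions, one for each particle, so that the energy is the
  sum over all pairs of an even periodic interaction \<open>\<Phi> (x\<^sub>i - x\<^sub>j)\<close>. On \<open>(0,\<Lambda>)\<close> the function \<open>\<Phi>\<close> is convex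
  and differentiable, and its derivative is locally Lipschitz and odd about \<open>\<Lambda>/2\<close>. Listing the
  particles cyclically, each one is pushed by the particle that lies \<open>k\<close> places behind it by the amount
  \<open>- \<Phi>'\<close> of their distance, for \<open>0 < k < \<Lambda>\<close>. For the two particles at the ends of the smallest gap,
  the distances to their respective \<open>k\<close>-th predecessors differ by that gap minus another one, so by
  convexity the smallest gap does not shrink. Hence \<open>\<Phi>'\<close> may be replaced near the singularity by a
  globally Lipschitz monotone function: the modified equation has a global solution, and this
  solution never enters the region where the equation was modified.
\<close>

text \<open>For \<open>1 < p < 2\<close> the integral defining the interaction converges for every
  \<open>r\<close>, even at \<open>r = 0\<close>. The energy thus stays finite at collisions, and
  its decrease cannot exclude them; the comparison of gaps has to. As
  \<open>max_existence_time\<close> is a supremum in \<open>ereal\<close>, one solution with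
  \<open>T = \<infinity>\<close> is enough. A further obstacle is that \<open>energy\<close> is
  defined through a \<open>SOME\<close> choice of \<open>u\<close>, known only up to null sets. But
  only increments of \<open>u\<close> enter, and for each fixed shift these are determined almost
  everywhere. The modified equation lives on the whole vector space: the truncation level is half of
  a lower bound for the initial gaps, and the sign of each force is read off from the initial order,
  so that the field is globally Lipschitz before anything is known about the trajectory.\<close>

section \<open>Smooth test functions\<close>

text \<open>An algebra of functions that is closed under differentiation, hence consists of smooth functions;
  closure under primitives gives a smooth step and its primitive.\<close>

inductive smooth_alg :: "(real \<Rightarrow> real) \<Rightarrow> bool" where
  base: "smooth_alg (\<lambda>x. if x \<le> 0 then 0 else exp (- 1 / x) / x ^ n)"
| add: "smooth_alg f \<Longrightarrow> smooth_alg g \<Longrightarrow> smooth_alg (\<lambda>x. f x + g x)"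
| mult: "smooth_alg f \<Longrightarrow> smooth_alg g \<Longrightarrow> smooth_alg (\<lambda>x. f x * g x)"
| cmult: "smooth_alg f \<Longrightarrow> smooth_alg (\<lambda>x. c * f x)"
| affine: "smooth_alg f \<Longrightarrow> smooth_alg (\<lambda>x. f (a * x + b))"
| primitive: "(\<And>x. (f has_real_derivative g x) (at x)) \<Longrightarrow> smooth_alg g \<Longrightarrow> smooth_alg f"

text \<open>The recursion keeps derivatives inside the family of base functions. The delicate point
  is 0, where the two one-sided limits of the difference quotient are treated separately.\<close>

lemma base_has_derivative:
  fixes n :: nat
  defines "e \<equiv> (\<lambda>n x::real. if x \<le> 0 then 0 else exp (- 1 / x) / x ^ n)"
  shows "(e n has_real_derivative (- real n * e (n + 1) x + e (n + 2) x)) (at x)"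
proof -
  consider "x < 0" | "x = 0" | "x > 0" by linarith
  then show ?thesis
  proof cases
    case 1
    have "((\<lambda>_. 0) has_real_derivative 0) (at x)" by simp
    moreover have "\<forall>\<^sub>F y in nhds x. 0 = e n y"
      using 1 eventually_nhds_in_open[of "{..<0}" x] by (auto simp: e_def elim!: eventually_mono)
    ultimately have "(e n has_real_derivative 0) (at x)"
      using DERIV_cong_ev[of x x "\<lambda>_. 0" "e n" 0 0] by simp
    with 1 show ?thesis by (simp add: e_def)
  next
    case 2
    have "((\<lambda>y. e n y / y) \<longlongrightarrow> 0) (at 0)"
    proof (rule filterlim_split_at_real)
      show "((\<lambda>y. e n y / y) \<longlongrightarrow> 0) (at_left 0)"
        by (rule tendsto_eventually) (auto simp: e_def eventually_at_filter)
      \<comment> \<open>Flatness at 0 from the right is the decay of this quotient at infinity,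
        transported by \<open>inverse\<close>.\<close>
      have "((\<lambda>y. y ^ (n + 1) / exp y) \<longlongrightarrow> (0::real)) at_top"
        by (rule tendsto_power_div_exp_0)
      then have "((\<lambda>y. inverse y ^ (n + 1) / exp (inverse y)) \<longlongrightarrow> (0::real)) (at_right 0)"
        by (rule filterlim_compose[OF _ filterlim_inverse_at_top_right])
      then show "((\<lambda>y. e n y / y) \<longlongrightarrow> 0) (at_right 0)"
        by (rule Lim_transform_eventually)
           (auto simp: e_def eventually_at_filter exp_minus field_simps)
    qed
    then show ?thesis using 2
      by (simp add: has_field_derivative_iff e_def)
  next
    case 3
    have 1: "((\<lambda>x. exp (- 1 / x)) has_real_derivative exp (- 1 / x) / x ^ 2) (at x)"
      using 3 by (auto intro!: derivative_eq_intros simp: power2_eq_square)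
    have 2: "((\<lambda>x. exp (- 1 / x) / x ^ n) has_real_derivative
        (exp (- 1 / x) / x ^ 2 * x ^ n - exp (- 1 / x) * (real n * x ^ (n - 1))) / (x ^ n * x ^ n)) (at x)"
      using 3 by (intro DERIV_divide 1) (auto intro: DERIV_pow[of n x, simplified])
    \<comment> \<open>The extra factor \<open>x\<close> absorbs the truncated subtraction
      \<open>n - 1\<close> at \<open>n = 0\<close>.\<close>
    have 4: "x * (real n * x ^ (n - 1)) = real n * x ^ n" by (cases n) auto
    have "(exp (- 1 / x) / x ^ 2 * x ^ n - exp (- 1 / x) * (real n * x ^ (n - 1))) / (x ^ n * x ^ n)
        = exp (- 1 / x) * (x ^ n - x * (x * (real n * x ^ (n - 1)))) / (x ^ 2 * x ^ n * x ^ n)"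
      using 3 by (simp add: field_simps power2_eq_square)
    also have "\<dots> = - real n * e (n + 1) x + e (n + 2) x"
      unfolding 4 using 3 by (simp add: e_def field_simps power2_eq_square)
    finally have "((\<lambda>x. exp (- 1 / x) / x ^ n) has_real_derivative (- real n * e (n + 1) x + e (n + 2) x)) (at x)"
      using 2 by simp
    moreover have "\<forall>\<^sub>F y in nhds x. exp (- 1 / y) / y ^ n = e n y"
      using 3 eventually_nhds_in_open[of "{0<..}" x] by (auto simp: e_def elim!: eventually_mono)
    ultimately show ?thesis
      using DERIV_cong_ev[of x x "\<lambda>x. exp (- 1 / x) / x ^ n" "e n"] by simp
  qed
qed

lemma smooth_alg_derivative:
  "smooth_alg f \<Longrightarrow> \<exists>g. smooth_alg g \<and> (\<forall>x. (f has_real_derivative g x) (at x))"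
proof (induction rule: smooth_alg.induct)
  case (base n)
  show ?case
    by (rule exI, rule conjI, rule smooth_alg.add[OF
        smooth_alg.cmult[OF smooth_alg.base[of "n + 1"], of "- real n"] smooth_alg.base[of "n + 2"]])
      (rule allI, rule base_has_derivative)
next
  case (add f g)
  then obtain f' g' where "smooth_alg f'" "smooth_alg g'"
    "\<forall>x. (f has_real_derivative f' x) (at x)" "\<forall>x. (g has_real_derivative g' x) (at x)" by blast
  then show ?case
    by (intro exI[of _ "\<lambda>x. f' x + g' x"] conjI smooth_alg.add) (auto intro!: derivative_eq_intros)
next
  case (mult f g)
  then obtain f' g' where "smooth_alg f'" "smooth_alg g'"
    "\<forall>x. (f has_real_derivative f' x) (at x)" "\<forall>x. (g has_real_derivative g' x) (at x)" by blast
  with mult.hyps show ?case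
    by (intro exI[of _ "\<lambda>x. f' x * g x + g' x * f x"] conjI smooth_alg.add smooth_alg.mult)
      (auto intro!: DERIV_mult)
next
  case (cmult f c)
  then obtain f' where "smooth_alg f'" "\<forall>x. (f has_real_derivative f' x) (at x)" by blast
  then show ?case
    by (intro exI[of _ "\<lambda>x. c * f' x"] conjI smooth_alg.cmult) (auto intro!: DERIV_cmult)
next
  case (affine f a b)
  then obtain f' where f': "smooth_alg f'" "\<And>x. (f has_real_derivative f' x) (at x)" by blast
  have "((\<lambda>x. f (a * x + b)) has_real_derivative a * f' (a * x + b)) (at x)" for x
    by (rule DERIV_cong[OF DERIV_chain2[OF f'(2)]]) (auto intro!: derivative_eq_intros)
  then show ?case using f'(1)
    by (intro exI[of _ "\<lambda>x. a * f' (a * x + b)"] conjI smooth_alg.cmult smooth_alg.affine) auto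
qed blast

lemma smooth_alg_higher_differentiable:
  assumes "smooth_alg f" shows "((deriv ^^ k) f) differentiable (at x)"
  using assms
proof (induction k arbitrary: f)
  case 0
  then show ?case
    using smooth_alg_derivative[of f] by (auto simp: real_differentiable_def)
next
  case (Suc k)
  obtain g where "smooth_alg g" "\<And>x. (f has_real_derivative g x) (at x)"
    using smooth_alg_derivative[OF Suc.prems] by blast
  then have "deriv f = g" by (auto intro!: DERIV_imp_deriv)
  with Suc.IH[OF \<open>smooth_alg g\<close>] show ?case by (simp add: funpow_swap1)
qed

lemma smooth_alg_isCont: "smooth_alg f \<Longrightarrow> isCont f x"
  using smooth_alg_derivative DERIV_isCont by blast

lemma smooth_alg_primitive_exists:
  assumes "smooth_alg g"
  obtains f where "smooth_alg f" "\<And>x. (f has_real_derivative g x) (at x)" "f 0 = 0"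
proof -
  have "\<exists>F. \<forall>x::real. - \<infinity> < ereal x \<longrightarrow> ereal x < \<infinity> \<longrightarrow> (F has_vector_derivative g x) (at x)"
    by (rule einterval_antiderivative) (auto intro: smooth_alg_isCont[OF assms])
  then obtain F where F: "\<And>x. (F has_real_derivative g x) (at x)"
    by (auto simp: has_real_derivative_iff_has_vector_derivative)
  have D: "((\<lambda>x. F x - F 0) has_real_derivative g x) (at x)" for x
    using F by (auto intro!: derivative_eq_intros)
  show thesis
    by (rule that[of "\<lambda>x. F x - F 0"]) (auto intro: D smooth_alg.primitive[OF D assms])
qed

text \<open>\<open>S\<close> is the normalised primitive of a bump supported in
  \<open>[0,1]\<close>, and \<open>R\<close> is a primitive of \<open>S\<close>. Since
  \<open>R\<close> is affine with slope 1 on the right, suitable second differences of its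
  translates have compact support.\<close>

lemma smooth_step_exists:
  "\<exists>R S. smooth_alg R \<and> smooth_alg S \<and> (\<forall>x. (R has_real_derivative S x) (at x)) \<and>
    (\<forall>x\<le>0. R x = 0) \<and> (\<forall>x\<ge>1. R x = R 1 + (x - 1)) \<and>
    (\<forall>x\<le>0. S x = 0) \<and> (\<forall>x\<ge>1. S x = 1) \<and> (\<forall>x. \<bar>S x\<bar> \<le> 1)"
proof -
  define e where "e = (\<lambda>x::real. if x \<le> 0 then 0 else exp (- 1 / x) / x ^ 0)"
  have e: "smooth_alg e" unfolding e_def by (rule smooth_alg.base)
  define b where "b = (\<lambda>x. e x * e ((- 1) * x + 1))"
  have b: "smooth_alg b" unfolding b_def by (intro smooth_alg.mult smooth_alg.affine e)
  have b0: "x \<le> 0 \<or> x \<ge> 1 \<Longrightarrow> b x = 0" and bpos: "b x \<ge> 0"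
    and bpos': "0 < x \<Longrightarrow> x < 1 \<Longrightarrow> b x > 0" for x
    by (auto simp: b_def e_def)
  obtain B where B: "smooth_alg B" "\<And>x. (B has_real_derivative b x) (at x)" "B 0 = 0"
    using smooth_alg_primitive_exists[OF b] by blast
  have mono: "x \<le> y \<Longrightarrow> B x \<le> B y" for x y
  proof (erule DERIV_nonneg_imp_nondecreasing)
    fix z show "\<exists>d. (B has_real_derivative d) (at z) \<and> 0 \<le> d"
      using B(2)[of z] bpos[of z] by blast
  qed
  have const: "B y = B x" if "x \<le> y" "\<And>z. x \<le> z \<Longrightarrow> z \<le> y \<Longrightarrow> b z = 0" for x y
  proof (cases "x = y")
    case False
    with that(1) have "x < y" by simp
    then have "\<exists>z. z > x \<and> z < y \<and> B y - B x = (y - x) * b z"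
      by (intro MVT2) (auto intro: B(2))
    with that show ?thesis by auto
  qed simp
  have "0 < (1::real)" by simp
  then have "\<exists>z. z > 0 \<and> z < 1 \<and> B 1 - B 0 = (1 - 0) * b z"
    by (intro MVT2) (auto intro: B(2))
  with B(3) bpos' have B1: "B 1 > 0" by auto
  define S where "S = (\<lambda>x. (1 / B 1) * B x)"
  have S: "smooth_alg S" unfolding S_def by (intro smooth_alg.cmult B)
  have S0: "S x = 0" if "x \<le> 0" for x
    using const[of x 0] that b0 B(3) by (simp add: S_def)
  have S1: "S x = 1" if "x \<ge> 1" for x
    using const[of 1 x] that b0 B1 by (simp add: S_def)
  have Sbd: "\<bar>S x\<bar> \<le> 1" for x
  proof (cases "x \<le> 0 \<or> x \<ge> 1")
    case False
    then show ?thesis using mono[of 0 x] mono[of x 1] B(3) B1 by (auto simp: S_def)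
  qed (auto simp: S0 S1)
  obtain R where R: "smooth_alg R" "\<And>x. (R has_real_derivative S x) (at x)" "R 0 = 0"
    using smooth_alg_primitive_exists[OF S] by blast
  have R0: "R x = 0" if "x \<le> 0" for x
  proof (cases "x = 0")
    case False
    with that have "x < 0" by simp
    then have "\<exists>z. z > x \<and> z < 0 \<and> R 0 - R x = (0 - x) * S z"
      by (intro MVT2) (auto intro: R(2))
    with R(3) S0 show ?thesis by auto
  qed (use R in simp)
  have R1: "R x = R 1 + (x - 1)" if "x \<ge> 1" for x
  proof (cases "x = 1")
    case False
    with that have "1 < x" by simp
    then have "\<exists>z. z > 1 \<and> z < x \<and> R x - R 1 = (x - 1) * S z"
      by (intro MVT2) (auto intro: R(2))
    with S1 show ?thesis by auto
  qed simp
  show ?thesis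
    by (intro exI[of _ R] exI[of _ S] conjI allI impI R S R0 R1 S0 S1 Sbd)
qed

section \<open>Uniqueness of potentials\<close>

text \<open>As \<open>ennreal\<close> sends negative numbers to 0, the positive and negative parts
  of \<open>g\<close> are the densities of two measures. These agree on half-open intervals, hence
  everywhere, so the two parts agree almost everywhere; at most one of them is nonzero at a
  point.\<close>

lemma AE_zero_if_Ioc_integrals_zero:
  fixes g :: "real \<Rightarrow> real"
  assumes [measurable]: "g \<in> borel_measurable borel"
    and int: "\<And>a b. set_integrable lborel {a..b} g"
    and zero: "\<And>a b. a \<le> b \<Longrightarrow> (LINT x:{a<..b}|lborel. g x) = 0"
  shows "AE x in lborel. g x = 0"
proof -
  have fin: "(\<integral>\<^sup>+ x. ennreal (g x) * indicator {a<..b} x \<partial>lborel) < \<infinity>"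
    and eq: "(\<integral>\<^sup>+ x. ennreal (g x) * indicator {a<..b} x \<partial>lborel)
      = (\<integral>\<^sup>+ x. ennreal (- g x) * indicator {a<..b} x \<partial>lborel)"
    if "a \<le> b" for a b
  proof -
    let ?g = "\<lambda>x. indicator {a<..b} x * g x"
    have "set_integrable lborel {a<..b} g"
      by (rule set_integrable_subset[OF int[of a b]]) auto
    then have I: "integrable lborel ?g" by (simp add: set_integrable_def)
    have 1: "(\<integral>\<^sup>+ x. ennreal (g x) * indicator {a<..b} x \<partial>lborel) = (\<integral>\<^sup>+ x. ennreal (?g x) \<partial>lborel)"
      "(\<integral>\<^sup>+ x. ennreal (- g x) * indicator {a<..b} x \<partial>lborel) = (\<integral>\<^sup>+ x. ennreal (- ?g x) \<partial>lborel)"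
      by (auto intro!: nn_integral_cong simp: indicator_def)
    have fin1: "(\<integral>\<^sup>+ x. ennreal (?g x) \<partial>lborel) < \<infinity>" "(\<integral>\<^sup>+ x. ennreal (- ?g x) \<partial>lborel) < \<infinity>"
      using I by (auto simp: real_integrable_def less_top)
    show "(\<integral>\<^sup>+ x. ennreal (g x) * indicator {a<..b} x \<partial>lborel) < \<infinity>" using 1 fin1 by simp
    have "enn2real (\<integral>\<^sup>+ x. ennreal (?g x) \<partial>lborel) - enn2real (\<integral>\<^sup>+ x. ennreal (- ?g x) \<partial>lborel) = 0"
      using zero[OF that] unfolding set_lebesgue_integral_def real_lebesgue_integral_def[OF I[simplified]]
      by (simp add: real_lebesgue_integral_def[OF I])
    then show "(\<integral>\<^sup>+ x. ennreal (g x) * indicator {a<..b} x \<partial>lborel)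
      = (\<integral>\<^sup>+ x. ennreal (- g x) * indicator {a<..b} x \<partial>lborel)"
      unfolding 1 using fin1
      by (metis add_0 diff_eq_eq ennreal_enn2real less_top infinity_ennreal_def)
  qed
  have "density lborel (\<lambda>x. ennreal (g x)) = density lborel (\<lambda>x. ennreal (- g x))"
  proof (rule measure_eqI_generator_eq[where \<Omega>=UNIV])
    fix X assume "X \<in> range (\<lambda>(a, b). {a<..b::real})"
    then obtain a b where X: "X = {a<..b}" by auto
    show "emeasure (density lborel (\<lambda>x. ennreal (g x))) X = emeasure (density lborel (\<lambda>x. ennreal (- g x))) X"
      by (cases "a \<le> b") (simp_all add: X emeasure_density eq)
  next
    show "(\<Union>i. {- real (i::nat)<..real i}) = UNIV"
      by (auto simp: set_eq_iff) (metis abs_less_iff less_imp_le minus_less_iff reals_Archimedean2)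
  next
    fix i :: nat
    show "emeasure (density lborel (\<lambda>x. ennreal (g x))) {- real i<..real i} \<noteq> \<infinity>"
      using fin[of "- real i" "real i"] by (simp add: emeasure_density less_top)
  qed (auto simp: borel_sigma_sets_Ioc Int_stable_def)
  then have "AE x in lborel. ennreal (g x) = ennreal (- g x)"
    by (intro sigma_finite_measure.density_unique[OF sigma_finite_lborel]) auto
  then show ?thesis
  proof eventually_elim
    fix x assume "ennreal (g x) = ennreal (- g x)"
    then show "g x = 0"
      by (cases "g x" "0::real" rule: linorder_cases) (simp_all add: ennreal_neg ennreal_eq_0_iff)
  qed
qed

lemma test_funE:
  assumes "test_fun \<phi>"
  obtains M C where "M > 0" "\<And>x. (\<phi> has_real_derivative deriv \<phi> x) (at x)"
    "\<And>x. isCont (deriv \<phi>) x" "\<And>x. \<bar>x\<bar> \<ge> M \<Longrightarrow> \<phi> x = 0" "\<And>x. \<bar>x\<bar> \<ge> M \<Longrightarrow> deriv \<phi> x = 0"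
    "\<And>x. \<bar>deriv \<phi> x\<bar> \<le> C"
proof -
  have d: "((deriv ^^ k) \<phi>) differentiable (at x)" for k x
    using assms by (simp add: test_fun_def)
  have D: "(\<phi> has_real_derivative deriv \<phi> x) (at x)" for x
    using d[of 0 x] by (simp add: DERIV_deriv_iff_real_differentiable)
  have cont: "isCont (deriv \<phi>) x" for x
    using d[of 1 x] by (simp add: differentiable_imp_continuous_within)
  have "bounded {x. \<phi> x \<noteq> 0}"
    using assms unfolding test_fun_def by (meson bounded_subset closure_subset compact_imp_bounded)
  then obtain m where m: "\<And>x. \<phi> x \<noteq> 0 \<Longrightarrow> \<bar>x\<bar> \<le> m"
    unfolding bounded_iff by auto
  \<comment> \<open>The extra 1 gives every \<open>x\<close> with
    \<open>\<bar>x\<bar> \<ge> M\<close> a neighbourhood on which \<open>\<phi>\<close> vanishes, so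
    that \<open>deriv \<phi>\<close> vanishes at \<open>x\<close> as well.\<close>
  define M where "M = \<bar>m\<bar> + 1"
  have z: "\<phi> x = 0" if "\<bar>x\<bar> > \<bar>m\<bar>" for x
    by (rule ccontr) (use m[of x] that in auto)
  have z': "deriv \<phi> x = 0" if "\<bar>x\<bar> \<ge> M" for x
  proof -
    have "x \<in> {y. \<bar>y\<bar> > \<bar>m\<bar>}" "open {y::real. \<bar>y\<bar> > \<bar>m\<bar>}"
      using that by (auto simp: M_def intro!: open_Collect_less continuous_intros)
    then have "\<forall>\<^sub>F y in nhds x. \<phi> y = 0"
      using eventually_nhds_in_open[of "{y. \<bar>y\<bar> > \<bar>m\<bar>}" x] z by (auto elim!: eventually_mono)
    then have "(\<phi> has_real_derivative 0) (at x)"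
      using DERIV_cong_ev[of x x \<phi> "\<lambda>_. 0" 0 0] by simp
    then show ?thesis by (rule DERIV_imp_deriv)
  qed
  have "compact (deriv \<phi> ` {-M..M})"
    by (intro compact_continuous_image continuous_at_imp_continuous_on ballI cont) simp
  then obtain C where C: "\<And>x. \<bar>x\<bar> \<le> M \<Longrightarrow> \<bar>deriv \<phi> x\<bar> \<le> C"
    by (force dest!: compact_imp_bounded simp: bounded_iff)
  have "\<bar>deriv \<phi> x\<bar> \<le> \<bar>C\<bar>" for x
    using C[of x] z'[of x] by (cases "\<bar>x\<bar> \<le> M") auto
  then show thesis
    by (intro that[of M "\<bar>C\<bar>"] D cont) (use z z' in \<open>auto simp: M_def\<close>)
qed

lemma integrable_mult_compact_support:
  fixes f g :: "real \<Rightarrow> real"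
  assumes [measurable]: "f \<in> borel_measurable borel" and g: "\<And>x. isCont g x"
    and int: "\<And>a b. set_integrable lborel {a..b} f"
    and "\<And>x. \<bar>x\<bar> \<ge> M \<Longrightarrow> g x = 0" "\<And>x. \<bar>g x\<bar> \<le> C"
  shows "integrable lborel (\<lambda>x. f x * g x)"
proof -
  have [measurable]: "g \<in> borel_measurable borel"
    using g by (intro borel_measurable_continuous_onI continuous_at_imp_continuous_on) auto
  have "integrable lborel (\<lambda>x. C * (indicator {-M..M} x * f x))"
    using int[of "-M" M] by (simp add: set_integrable_def)
  then show ?thesis
  proof (rule Bochner_Integration.integrable_bound)
    show "AE x in lborel. norm (f x * g x) \<le> norm (C * (indicat_real {- M..M} x * f x))"
    proof (intro AE_I2)
      fix x
      have "\<bar>f x\<bar> * \<bar>g x\<bar> \<le> \<bar>f x\<bar> * \<bar>C\<bar>" using assms(5)[of x] by (intro mult_left_mono) auto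
      then show "norm (f x * g x) \<le> norm (C * (indicat_real {- M..M} x * f x))"
        using assms(4)[of x] by (cases "\<bar>x\<bar> \<le> M") (auto simp: abs_mult indicator_def mult.commute)
    qed
  qed simp
qed

text \<open>The test functions are second differences of the rescaled primitive of a smooth step, whose
  derivatives converge boundedly to the difference of the indicators of an interval and its translate.\<close>

lemma translation_invariant_if_distributional_derivative_zero:
  fixes f :: "real \<Rightarrow> real"
  assumes [measurable]: "f \<in> borel_measurable borel"
    and int: "\<And>a b. set_integrable lborel {a..b} f"
    and weak: "\<And>\<phi>. test_fun \<phi> \<Longrightarrow> (LINT x|lborel. f x * deriv \<phi> x) = 0"
  shows "AE x in lborel. f (x + h) = f x"
proof -
  obtain R S where R: "smooth_alg R" and S: "smooth_alg S"
    and RS: "\<And>x. (R has_real_derivative S x) (at x)"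
    and R0: "\<And>x. x \<le> 0 \<Longrightarrow> R x = 0" and R1: "\<And>x. x \<ge> 1 \<Longrightarrow> R x = R 1 + (x - 1)"
    and S0: "\<And>x. x \<le> 0 \<Longrightarrow> S x = 0" and S1: "\<And>x. x \<ge> 1 \<Longrightarrow> S x = 1" and Sb: "\<And>x. \<bar>S x\<bar> \<le> 1"
    using smooth_step_exists by metis
  have [measurable]: "S \<in> borel_measurable borel"
    using smooth_alg_isCont[OF S]
    by (intro borel_measurable_continuous_onI continuous_at_imp_continuous_on) auto
  have Ioc: "set_integrable lborel {a<..b} f" for a b
    by (rule set_integrable_subset[OF int[of a b]]) auto
  have key: "(LINT x:{a<..b}|lborel. f x) = (LINT x:{a+h<..b+h}|lborel. f x)" if "a \<le> b" for a b
  proof -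
    \<comment> \<open>Each rescaled step is completed within length \<open>1 / N n \<le> 1\<close>;
      hence the margin 1, and one compact interval contains all supports.\<close>
    define lo hi where "lo = min a (a + h)" and "hi = max b (b + h) + 1"
    define N where "N = (\<lambda>n. real (Suc n))"
    define D where "D = (\<lambda>n x. S (N n * x + - N n * a) + (- 1) * S (N n * x + - N n * b)
       + (- 1) * S (N n * x + - N n * (a + h)) + S (N n * x + - N n * (b + h)))"
    define \<phi> where "\<phi> = (\<lambda>n x. (1 / N n) * (R (N n * x + - N n * a) + (- 1) * R (N n * x + - N n * b)
       + (- 1) * R (N n * x + - N n * (a + h)) + R (N n * x + - N n * (b + h))))"
    have N1: "N n \<ge> 1" for n by (simp add: N_def)
    have le0: "N n * x + - N n * c \<le> 0" if "x \<le> c" for n x c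
      using that N1[of n] by (simp add: mult_left_mono)
    have ge1: "N n * x + - N n * c \<ge> 1" if "x \<ge> c + 1" for n x c
    proof -
      have "1 * 1 \<le> N n * (x - c)" using that N1[of n] by (intro mult_mono) auto
      then show ?thesis by (simp add: algebra_simps)
    qed
    have DR: "((\<lambda>x. R (N n * x + - N n * c)) has_real_derivative N n * S (N n * x + - N n * c)) (at x)" for n c x
      by (rule DERIV_cong[OF DERIV_chain2[OF RS]]) (auto intro!: derivative_eq_intros)
    have deriv: "deriv (\<phi> n) x = D n x" for n x
    proof (rule DERIV_imp_deriv)
      have "(\<phi> n has_real_derivative (1 / N n) * (N n * S (N n * x + - N n * a) + (- 1) * (N n * S (N n * x + - N n * b))
       + (- 1) * (N n * S (N n * x + - N n * (a + h))) + N n * S (N n * x + - N n * (b + h)))) (at x)"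
        unfolding \<phi>_def by (intro DERIV_cmult DERIV_add DR)
      then show "(\<phi> n has_real_derivative D n x) (at x)"
        by (rule DERIV_cong) (use N1[of n] in \<open>simp add: D_def field_simps\<close>)
    qed
    have alg: "smooth_alg (\<phi> n)" for n
    proof -
      have A: "smooth_alg (\<lambda>x. R (N n * x + - N n * c))" for c by (rule smooth_alg.affine[OF R])
      note C = smooth_alg.cmult[OF A, of "- 1"]
      show ?thesis unfolding \<phi>_def
        by (rule smooth_alg.cmult[OF smooth_alg.add[OF smooth_alg.add[OF smooth_alg.add[OF A C] C] A]])
    qed
    have supp: "\<phi> n x = 0" "D n x = 0" if "x \<notin> {lo..hi}" for n x
    proof -
      consider "x < lo" | "x > hi" using \<open>x \<notin> {lo..hi}\<close> by force
      then have "\<phi> n x = 0 \<and> D n x = 0"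
      proof cases
        case 1
        then have "x \<le> a" "x \<le> b" "x \<le> a + h" "x \<le> b + h"
          using \<open>a \<le> b\<close> by (auto simp: lo_def)
        note le = this[THEN le0[of _ _ n]]
        show ?thesis unfolding \<phi>_def D_def by (simp_all only: R0[OF le(1)] R0[OF le(2)] R0[OF le(3)] R0[OF le(4)]
            S0[OF le(1)] S0[OF le(2)] S0[OF le(3)] S0[OF le(4)]) simp_all
      next
        case 2
        then have "x \<ge> a + 1" "x \<ge> b + 1" "x \<ge> a + h + 1" "x \<ge> b + h + 1"
          using \<open>a \<le> b\<close> by (auto simp: hi_def)
        \<comment> \<open>To the right the four affine tails cancel, because a - b - (a + h) + (b +
          h) = 0.\<close>
        note ge = this[THEN ge1[of _ _ n]]
        show ?thesis unfolding \<phi>_def D_def by (simp_all only: R1[OF ge(1)] R1[OF ge(2)] R1[OF ge(3)] R1[OF ge(4)]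
            S1[OF ge(1)] S1[OF ge(2)] S1[OF ge(3)] S1[OF ge(4)]) (simp_all add: algebra_simps)
      qed
      then show "\<phi> n x = 0" "D n x = 0" by auto
    qed
    have test: "test_fun (\<phi> n)" for n
    proof -
      have "{x. \<phi> n x \<noteq> 0} \<subseteq> {lo..hi}" using supp by blast
      then have "closure {x. \<phi> n x \<noteq> 0} \<subseteq> {lo..hi}" by (simp add: closure_minimal)
      then have "compact (closure {x. \<phi> n x \<noteq> 0})"
        by (meson closed_closure compact_Icc compact_Int_closed compact_eq_bounded_closed bounded_subset)
      then show ?thesis using smooth_alg_higher_differentiable[OF alg] by (simp add: test_fun_def)
    qed
    define l where "l = (\<lambda>x. f x * (indicator {a<..b} x - indicator {a+h<..b+h} x))"
    have [measurable]: "D n \<in> borel_measurable borel" for n unfolding D_def by measurable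
    have "(\<lambda>n. LINT x|lborel. f x * D n x) \<longlonglongrightarrow> (LINT x|lborel. l x)"
    proof (rule integral_dominated_convergence)
      show "integrable lborel (\<lambda>x. 4 * \<bar>indicator {lo..hi} x * f x\<bar>)"
        using int[of lo hi] by (simp add: set_integrable_def)
      show "AE x in lborel. (\<lambda>n. f x * D n x) \<longlonglongrightarrow> l x"
      proof (intro AE_I2)
        fix x
        \<comment> \<open>At \<open>x = c\<close> the limit is \<open>S 0 = 0\<close>, which is why
          the intervals are open on the left and closed on the right.\<close>
        have lim: "(\<lambda>n. S (N n * x + - N n * c)) \<longlonglongrightarrow> (if x > c then 1 else 0)" for c
        proof (cases "x > c")
          case True
          obtain m :: nat where m: "1 < real m * (x - c)" using reals_Archimedean3[of "x - c"] True by auto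
          have "S (N n * x + - N n * c) = 1" if "n \<ge> m" for n
          proof -
            have "real m * (x - c) \<le> N n * (x - c)" using that True by (intro mult_right_mono) (auto simp: N_def)
            with m show ?thesis by (intro S1) (simp add: algebra_simps)
          qed
          then have "\<forall>\<^sub>F n in sequentially. S (N n * x + - N n * c) = 1"
            by (auto simp: eventually_sequentially)
          with True show ?thesis by (simp add: tendsto_eventually)
        next
          case False
          then show ?thesis using le0[of x c] S0 by simp
        qed
        have "(\<lambda>n. f x * D n x) \<longlonglongrightarrow> f x * ((if x > a then 1 else 0) + (-1) * (if x > b then 1 else 0)
           + (-1) * (if x > a + h then 1 else 0) + (if x > b + h then 1 else 0))"
          unfolding D_def by (intro tendsto_intros lim)
        also have "f x * ((if x > a then 1 else 0) + (-1) * (if x > b then 1 else 0)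
           + (-1) * (if x > a + h then 1 else 0) + (if x > b + h then 1 else 0)) = l x"
          using \<open>a \<le> b\<close> by (auto simp: l_def indicator_def)
        finally show "(\<lambda>n. f x * D n x) \<longlonglongrightarrow> l x" .
      qed
      show "AE x in lborel. norm (f x * D n x) \<le> 4 * \<bar>indicator {lo..hi} x * f x\<bar>" for n
      proof (intro AE_I2)
        fix x
        have "\<bar>D n x\<bar> \<le> 4"
          unfolding D_def
          using Sb[of "N n * x + - N n * a"] Sb[of "N n * x + - N n * b"]
            Sb[of "N n * x + - N n * (a + h)"] Sb[of "N n * x + - N n * (b + h)"] by linarith
        then have "\<bar>f x\<bar> * \<bar>D n x\<bar> \<le> \<bar>f x\<bar> * 4" by (intro mult_left_mono) auto
        then show "norm (f x * D n x) \<le> 4 * \<bar>indicator {lo..hi} x * f x\<bar>"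
          using supp(2)[of x n] by (cases "x \<in> {lo..hi}") (auto simp: abs_mult)
      qed
    qed (auto simp: l_def)
    moreover have "(LINT x|lborel. f x * D n x) = 0" for n
      using weak[OF test[of n]] by (simp add: deriv)
    ultimately have "(LINT x|lborel. l x) = 0"
      using LIMSEQ_unique by (metis (no_types, lifting) ext tendsto_const)
    with Ioc[of a b] Ioc[of "a+h" "b+h"] show ?thesis
      by (simp add: l_def set_lebesgue_integral_def set_integrable_def right_diff_distrib mult.commute)
  qed
  have shift: "integrable lborel (\<lambda>x. indicator {a<..b} x * f (x + h))"
    "(LINT x|lborel. indicator {a<..b} x * f (x + h)) = (LINT x:{a+h<..b+h}|lborel. f x)"
    "integrable lborel (\<lambda>x. indicator {a..b} x * f (x + h))" for a b
  proof -
    have 1: "integrable lborel (\<lambda>x. indicator {a+h<..b+h} x * f x)"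
      using Ioc[of "a+h" "b+h"] by (simp add: set_integrable_def)
    have 2: "integrable lborel (\<lambda>x. indicator {a+h..b+h} x * f x)"
      using int[of "a+h" "b+h"] by (auto simp: set_integrable_def)
    have ind: "indicator {a+h<..b+h} (x + h) = (indicator {a<..b} x :: real)"
      "indicator {a+h..b+h} (x + h) = (indicator {a..b} x :: real)" for x
      by (auto simp: indicator_def)
    show "integrable lborel (\<lambda>x. indicator {a<..b} x * f (x + h))"
      using lborel_integrable_real_affine[OF 1, of 1 h] by (simp add: ind add.commute[of h])
    show "integrable lborel (\<lambda>x. indicator {a..b} x * f (x + h))"
      using lborel_integrable_real_affine[OF 2, of 1 h] by (simp add: ind add.commute[of h])
    show "(LINT x|lborel. indicator {a<..b} x * f (x + h)) = (LINT x:{a+h<..b+h}|lborel. f x)"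
      unfolding set_lebesgue_integral_def
      by (subst (2) lborel_integral_real_affine[of 1 _ h]) (simp_all add: ind add.commute[of h])
  qed
  have "AE x in lborel. f (x + h) - f x = 0"
  proof (rule AE_zero_if_Ioc_integrals_zero)
    show "set_integrable lborel {a..b} (\<lambda>x. f (x + h) - f x)" for a b
      using shift(3)[of a b] int[of a b] by (simp add: set_integrable_def right_diff_distrib)
    show "(LINT x:{a<..b}|lborel. f (x + h) - f x) = 0" if "a \<le> b" for a b
    proof -
      have "integrable lborel (\<lambda>x. indicator {a<..b} x * f x)"
        using Ioc[of a b] by (simp add: set_integrable_def)
      then show ?thesis
        using key[OF that] shift[of a b] by (simp add: set_lebesgue_integral_def right_diff_distrib)
    qed
  qed simp
  then show ?thesis by simp
qed

text \<open>The difference of two potentials has distributional derivative 0, so it is invariant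
  under translation. The exceptional null set may depend on \<open>h\<close>; the energy is
  therefore integrated over \<open>x\<close> with the shift fixed.\<close>

lemma potential_diff_AE:
  assumes u: "is_potential X u" and v: "is_potential X v"
  shows "AE x in lborel. u (x + h) - u x = v (x + h) - v x"
proof -
  have [measurable]: "u \<in> borel_measurable borel" "v \<in> borel_measurable borel"
    and int: "\<And>a b. set_integrable lborel {a..b} u" "\<And>a b. set_integrable lborel {a..b} v"
    using u v by (auto simp: is_potential_def)
  have "AE x in lborel. (\<lambda>x. u x - v x) (x + h) = (\<lambda>x. u x - v x) x"
  proof (rule translation_invariant_if_distributional_derivative_zero)
    show "set_integrable lborel {a..b} (\<lambda>x. u x - v x)" for a b
      using int by (simp add: set_integral_diff)
    fix \<phi> assume t: "test_fun \<phi>"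
    obtain M C where 1: "\<And>x. isCont (deriv \<phi>) x" "\<And>x. \<bar>x\<bar> \<ge> M \<Longrightarrow> deriv \<phi> x = 0"
      "\<And>x. \<bar>deriv \<phi> x\<bar> \<le> C" using test_funE[OF t] by metis
    have "integrable lborel (\<lambda>x. u x * deriv \<phi> x)" "integrable lborel (\<lambda>x. v x * deriv \<phi> x)"
      by (rule integrable_mult_compact_support[where M=M and C=C]; use 1 int in simp)+
    moreover have "(LINT x|lborel. u x * deriv \<phi> x) = (LINT x|lborel. v x * deriv \<phi> x)"
      using u v t unfolding is_potential_def by force
    ultimately show "(LINT x|lborel. (u x - v x) * deriv \<phi> x) = 0"
      by (simp add: left_diff_distrib)
  qed simp
  then show ?thesis by eventually_elim simp
qed

section \<open>The explicit potential\<close>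

text \<open>Each summand has slope \<open>1 / CARD('n)\<close> and drops by 1 at every copy of its
  particle; the \<open>CARD('n)\<close> slopes add up to 1.\<close>

definition saw_potential :: "real ^ 'n \<Rightarrow> real \<Rightarrow> real" where
  "saw_potential X x = (\<Sum>i\<in>UNIV. frac ((x - X $ i) / real CARD('n)))"

lemma borel_measurable_frac [measurable (raw)]:
  fixes f :: "'a \<Rightarrow> real"
  assumes [measurable]: "f \<in> borel_measurable M"
  shows "(\<lambda>x. frac (f x)) \<in> borel_measurable M"
  unfolding frac_def by measurable

text \<open>On each period \<open>frac\<close> is affine and rises from 0 to 1, so integration by
  parts leaves only the value of \<open>\<phi>\<close> at the right end of the period. Hence the
  index set \<open>{a<..b}\<close>.\<close>

lemma saw_by_parts:
  fixes \<phi> :: "real \<Rightarrow> real" and a b :: int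
  assumes D: "\<And>x. (\<phi> has_real_derivative \<phi>' x) (at x)" and L: "L > 0" and "a \<le> b"
  shows "((\<lambda>x. frac ((x - c) / L) * \<phi>' x + \<phi> x / L) has_integral
    (\<Sum>k\<in>{a<..b}. \<phi> (c + L * of_int k))) {c + L * of_int a..c + L * of_int b}"
  using \<open>a \<le> b\<close>
proof (induction b rule: int_ge_induct)
  case (step b)
  let ?l = "c + L * of_int b" and ?r = "c + L * of_int (b + 1)"
  have lr: "?l \<le> ?r" using L by (simp add: algebra_simps)
  have "((\<lambda>x. ((x - c) / L - of_int b) * \<phi>' x + \<phi> x / L) has_integral
      ((?r - c) / L - of_int b) * \<phi> ?r - ((?l - c) / L - of_int b) * \<phi> ?l) {?l..?r}"
  proof (rule fundamental_theorem_of_calculus[OF lr])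
    fix x assume "x \<in> {?l..?r}"
    have "((\<lambda>x. ((x - c) / L - of_int b) * \<phi> x) has_real_derivative
       ((x - c) / L - of_int b) * \<phi>' x + \<phi> x / L) (at x)"
      using L by (auto intro!: derivative_eq_intros D simp: field_simps)
    then show "((\<lambda>x. ((x - c) / L - of_int b) * \<phi> x) has_vector_derivative
       ((x - c) / L - of_int b) * \<phi>' x + \<phi> x / L) (at x within {?l..?r})"
      by (simp add: has_real_derivative_iff_has_vector_derivative has_vector_derivative_at_within)
  qed
  moreover have "((?r - c) / L - of_int b) * \<phi> ?r - ((?l - c) / L - of_int b) * \<phi> ?l = \<phi> ?r"
    using L by (simp add: field_simps)
  ultimately have "((\<lambda>x. ((x - c) / L - of_int b) * \<phi>' x + \<phi> x / L) has_integral \<phi> ?r) {?l..?r}"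
    by simp
  \<comment> \<open>At the right end of the cell \<open>frac\<close> is 0 and the affine function is
    1; this single point is spiked away.\<close>
  then have "((\<lambda>x. frac ((x - c) / L) * \<phi>' x + \<phi> x / L) has_integral \<phi> ?r) {?l..?r}"
  proof (rule has_integral_spike_finite[rotated 2])
    fix x assume "x \<in> {?l..?r} - {?r}"
    then have "of_int b \<le> (x - c) / L" "(x - c) / L < of_int b + 1"
      using L by (auto simp: field_simps)
    then have "\<lfloor>(x - c) / L\<rfloor> = b" by (simp add: floor_eq_iff)
    then show "frac ((x - c) / L) * \<phi>' x + \<phi> x / L = ((x - c) / L - of_int b) * \<phi>' x + \<phi> x / L"
      by (simp add: frac_def)
  qed simp
  from has_integral_combine[OF _ lr step.IH this] L step.hyps
  have "((\<lambda>x. frac ((x - c) / L) * \<phi>' x + \<phi> x / L) has_integral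
    (\<Sum>k\<in>{a<..b}. \<phi> (c + L * of_int k)) + \<phi> ?r) {c + L * of_int a..?r}"
    by simp
  moreover have "{a<..b + 1} = insert (b + 1) {a<..b}" using step.hyps by auto
  ultimately show ?case by (simp add: add.commute)
next
  case base
  show ?case by (rule has_integral_eq_rhs[OF has_integral_null_real]) auto
qed

lemma integrable_frac_mult:
  fixes g :: "real \<Rightarrow> real"
  assumes "integrable lborel g"
  shows "integrable lborel (\<lambda>x. frac ((x - c) / L) * g x)"
proof (rule Bochner_Integration.integrable_bound[OF assms])
  show "AE x in lborel. norm (frac ((x - c) / L) * g x) \<le> norm (g x)"
  proof (intro AE_I2)
    fix x
    have "\<bar>frac ((x - c) / L)\<bar> \<le> 1" using frac_lt_1[of "(x - c) / L"] frac_ge_0[of "(x - c) / L"] by linarith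
    then have "\<bar>frac ((x - c) / L)\<bar> * \<bar>g x\<bar> \<le> 1 * \<bar>g x\<bar>" by (intro mult_right_mono) auto
    then show "norm (frac ((x - c) / L) * g x) \<le> norm (g x)" by (simp add: abs_mult)
  qed
qed (use assms in simp)

text \<open>Each particle is integrated by parts over finitely many periods covering the support of
  \<open>\<phi>\<close>. This yields the sum of \<open>\<phi>\<close> over its copies minus the
  fraction \<open>1 / CARD('n)\<close> of the integral of \<open>\<phi>\<close>, and these fractions
  add up to the whole integral.\<close>

lemma is_potential_saw_potential: "is_potential X (saw_potential X)"
  for X :: "real ^ 'n"
proof -
  let ?L = "real CARD('n)"
  have L: "?L > 0" by simp
  have [measurable]: "saw_potential X \<in> borel_measurable borel"
    unfolding saw_potential_def by measurable
  have int1: "integrable lborel (\<lambda>x. indicator {a..b} x :: real)" for a b :: real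
    by (rule integrable_real_indicator) (auto simp: emeasure_lborel_Icc_eq)
  have "set_integrable lborel {a..b} (saw_potential X)" for a b
  proof -
    have "integrable lborel (\<lambda>x. \<Sum>i\<in>UNIV. frac ((x - X $ i) / ?L) * indicator {a..b} x)"
      by (intro Bochner_Integration.integrable_sum integrable_frac_mult int1)
    then show ?thesis
      unfolding set_integrable_def saw_potential_def real_scaleR_def sum_distrib_left
      by (simp only: mult.commute)
  qed
  moreover have "saw_potential X (x + ?L) = saw_potential X x" for x
  proof -
    have "frac ((x + ?L - c) / ?L) = frac ((x - c) / ?L)" for c
    proof -
      have "(x + ?L - c) / ?L = (x - c) / ?L + 1" by (simp add: field_simps)
      then show ?thesis by (simp add: frac_def)
    qed
    then show ?thesis by (simp add: saw_potential_def)
  qed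
  moreover have "- (LINT x|lborel. saw_potential X x * deriv \<phi> x) =
          (LINT x|lborel. \<phi> x) - (LINT x|config_measure X. \<phi> x)" if t: "test_fun \<phi>" for \<phi>
  proof -
    obtain M C where M: "M > 0" and D: "\<And>x. (\<phi> has_real_derivative deriv \<phi> x) (at x)"
      and cont: "\<And>x. isCont (deriv \<phi>) x" and supp: "\<And>x. \<bar>x\<bar> \<ge> M \<Longrightarrow> \<phi> x = 0"
      "\<And>x. \<bar>x\<bar> \<ge> M \<Longrightarrow> deriv \<phi> x = 0"
      using test_funE[OF t] by metis
    have int: "integrable lborel g" if "\<And>x. isCont g x" "\<And>x. \<bar>x\<bar> \<ge> M \<Longrightarrow> g x = 0" for g :: "real \<Rightarrow> real"
    proof -
      have "set_integrable lborel {-M..M} g"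
        unfolding set_integrable_def using that(1)
        by (intro borel_integrable_compact continuous_at_imp_continuous_on) auto
      moreover have "(\<lambda>x. indicator {-M..M} x *\<^sub>R g x) = g"
      proof
        fix x show "indicator {-M..M} x *\<^sub>R g x = g x"
          using that(2)[of x] by (cases "\<bar>x\<bar> \<ge> M") (auto simp: indicator_def)
      qed
      ultimately show ?thesis unfolding set_integrable_def by (simp only:)
    qed
    have int\<phi>: "integrable lborel \<phi>" using DERIV_isCont[OF D] supp by (intro int) auto
    have int\<phi>': "integrable lborel (deriv \<phi>)" using cont supp by (intro int) auto
    \<comment> \<open>Summing all \<open>\<bar>X $ i\<bar>\<close> makes one window size work for
      every particle.\<close>
    obtain N0 :: nat where N0: "M + (\<Sum>i\<in>UNIV. \<bar>X $ i\<bar>) < real N0 * ?L"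
      using reals_Archimedean3[OF L] by blast
    define N where "N = int N0"
    have N: "M + \<bar>X $ i\<bar> < of_int N * ?L" for i
      using N0 member_le_sum[of i UNIV "\<lambda>i. \<bar>X $ i\<bar>"] by (simp add: N_def)
    have out: "\<phi> (X $ i + ?L * of_int k) = 0" if "k \<notin> {-N<..N}" for i k
    proof -
      from that have "k \<ge> N + 1 \<or> k \<le> -N" by auto
      then have "\<bar>of_int k :: real\<bar> \<ge> of_int N" by linarith
      then have "?L * \<bar>of_int k\<bar> \<ge> ?L * of_int N" by (intro mult_left_mono) auto
      then have "\<bar>?L * of_int k\<bar> \<ge> of_int N * ?L" by (simp add: abs_mult mult.commute)
      then show ?thesis using N[of i] M by (intro supp) linarith
    qed
    have one: "(LINT x|lborel. frac ((x - X $ i) / ?L) * deriv \<phi> x) =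
        (\<Sum>k\<in>{-N<..N}. \<phi> (X $ i + ?L * of_int k)) - (LINT x|lborel. \<phi> x) / ?L" for i
    proof -
      let ?f = "\<lambda>x. frac ((x - X $ i) / ?L) * deriv \<phi> x + \<phi> x / ?L"
      have "(?f has_integral (\<Sum>k\<in>{-N<..N}. \<phi> (X $ i + ?L * of_int k)))
         {X $ i + ?L * of_int (-N)..X $ i + ?L * of_int N}"
        using L by (intro saw_by_parts D) (auto simp: N_def)
      then have 1: "(?f has_integral (\<Sum>k\<in>{-N<..N}. \<phi> (X $ i + ?L * of_int k))) UNIV"
      proof (rule has_integral_on_superset)
        fix x assume "x \<notin> {X $ i + ?L * of_int (-N)..X $ i + ?L * of_int N}"
        then have "\<bar>x\<bar> \<ge> M" using N[of i] by (auto simp: mult.commute)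
        then show "?f x = 0" by (simp add: supp)
      qed simp
      have "integrable lborel ?f"
        by (intro Bochner_Integration.integrable_add integrable_frac_mult int\<phi>' integrable_divide int\<phi>)
      from has_integral_integral_lborel[OF this] 1
      have "(LINT x|lborel. ?f x) = (\<Sum>k\<in>{-N<..N}. \<phi> (X $ i + ?L * of_int k))"
        by (rule has_integral_unique)
      moreover have "(LINT x|lborel. ?f x) = (LINT x|lborel. frac ((x - X $ i) / ?L) * deriv \<phi> x)
          + (LINT x|lborel. \<phi> x / ?L)"
        by (intro Bochner_Integration.integral_add integrable_frac_mult int\<phi>' integrable_divide int\<phi>)
      ultimately show ?thesis by simp
    qed
    have "(LINT x|lborel. saw_potential X x * deriv \<phi> x) =
       (\<Sum>i\<in>UNIV. (LINT x|lborel. frac ((x - X $ i) / ?L) * deriv \<phi> x))"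
      unfolding saw_potential_def sum_distrib_right
      by (intro Bochner_Integration.integral_sum integrable_frac_mult int\<phi>')
    also have "\<dots> = (\<Sum>i\<in>UNIV. \<Sum>k\<in>{-N<..N}. \<phi> (X $ i + ?L * of_int k)) - (LINT x|lborel. \<phi> x)"
      unfolding one by (simp add: sum_subtractf)
    finally have lhs: "(LINT x|lborel. saw_potential X x * deriv \<phi> x) = \<dots>" .
    have [measurable]: "\<phi> \<in> borel_measurable borel" using int\<phi> by simp
    let ?g = "\<lambda>p :: 'n \<times> int. \<phi> (X $ fst p + ?L * of_int (snd p))"
    have "(LINT x|config_measure X. \<phi> x) = (LINT p|count_space UNIV. ?g p)"
      unfolding config_measure_def
      by (subst integral_distr) (auto simp: case_prod_beta)
    also have "\<dots> = (\<Sum>p | p \<in> UNIV \<and> ?g p \<noteq> 0. ?g p)"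
    proof (rule lebesgue_integral_count_space_finite_support)
      have "{p \<in> UNIV. ?g p \<noteq> 0} \<subseteq> UNIV \<times> {-N<..N}" using out by force
      then show "finite {p \<in> UNIV. ?g p \<noteq> 0}" by (rule finite_subset) auto
    qed
    also have "\<dots> = (\<Sum>p\<in>UNIV \<times> {-N<..N}. ?g p)"
      by (rule sum.mono_neutral_left) (use out in force)+
    also have "\<dots> = (\<Sum>i\<in>UNIV. \<Sum>k\<in>{-N<..N}. \<phi> (X $ i + ?L * of_int k))"
      by (simp add: sum.cartesian_product case_prod_beta)
    finally show ?thesis using lhs by simp
  qed
  ultimately show ?thesis by (simp add: is_potential_def)
qed

section \<open>The energy as a pair interaction\<close>

text \<open>Up to affine transformations, \<open>hat (t / L)\<close> is the autocorrelation of the sawtooth function of period \<open>L\<close>.\<close>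

definition hat :: "real \<Rightarrow> real" where
  "hat t = frac t * (1 - frac t)"

lemma hat_of_int_add [simp]: "hat (of_int n + t) = hat t" "hat (t + of_int n) = hat t"
  by (simp_all add: hat_def)

lemma hat_minus [simp]: "hat (- t) = hat t"
  by (auto simp: hat_def frac_neg)

lemma hat_nonneg: "0 \<le> hat t"
  using frac_lt_1[of t] by (simp add: hat_def)

lemma hat_le_1: "hat t \<le> 1"
  using frac_lt_1[of t] frac_ge_0[of t] mult_mono[of "frac t" 1 "1 - frac t" 1] by (simp add: hat_def)

lemma hat_eq: "0 \<le> t \<Longrightarrow> t \<le> 1 \<Longrightarrow> hat t = t * (1 - t)"
  by (cases "t = 1") (auto simp: hat_def frac_eq[THEN iffD2])

text \<open>With the fractional parts a and b of the arguments, the defect is 2 a b if they add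
  without carry, and 2 (1 - a) (1 - b) otherwise.\<close>

lemma hat_add_le: "hat (s + t) \<le> hat s + hat t"
proof -
  define a b where "a = frac s" and "b = frac t"
  have ab: "0 \<le> a" "a < 1" "0 \<le> b" "b < 1" by (auto simp: a_def b_def frac_lt_1)
  have nn: "0 \<le> a * b" "0 \<le> (1 - a) * (1 - b)" using ab by auto
  show ?thesis
  proof (cases "a + b < 1")
    case True
    then have fr: "frac (s + t) = a + b" by (simp add: frac_add a_def b_def)
    have "hat (s + t) = (a + b) * (1 - (a + b))" by (simp add: hat_def fr)
    also have "\<dots> = hat s + hat t - 2 * (a * b)"
      unfolding hat_def a_def[symmetric] b_def[symmetric] by algebra
    finally show ?thesis using nn by simp
  next
    case False
    then have fr: "frac (s + t) = a + b - 1" by (simp add: frac_add a_def b_def)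
    have "hat (s + t) = (a + b - 1) * (1 - (a + b - 1))" unfolding hat_def fr ..
    also have "\<dots> = hat s + hat t - 2 * ((1 - a) * (1 - b))"
      unfolding hat_def a_def[symmetric] b_def[symmetric] by algebra
    finally show ?thesis using nn by simp
  qed
qed

lemma abs_hat_diff_le: "\<bar>hat (s + t) - hat s\<bar> \<le> hat t"
  using hat_add_le[of s t] hat_add_le[of "s + t" "- t"] by (simp add: abs_le_iff)

lemma hat_le_abs: "hat t \<le> \<bar>t\<bar>"
proof -
  have 1: "hat t \<le> t" if "0 \<le> t" for t
  proof -
    have "frac t \<le> t" using that by (simp add: frac_def)
    moreover have "frac t * (1 - frac t) \<le> frac t * 1"
      by (intro mult_left_mono) auto
    ultimately show ?thesis by (simp add: hat_def)
  qed
  show ?thesis using 1[of t] 1[of "- t"] by (cases "t \<ge> 0") auto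
qed

lemma borel_measurable_hat [measurable (raw)]:
  fixes f :: "'a \<Rightarrow> real"
  assumes [measurable]: "f \<in> borel_measurable M"
  shows "(\<lambda>x. hat (f x)) \<in> borel_measurable M"
  unfolding hat_def by measurable

section \<open>Autocorrelation of the sawtooth\<close>

lemma has_integral_product_linear:
  fixes a b c d :: real
  assumes "c \<le> d"
  shows "((\<lambda>x. (x + a) * (x + b)) has_integral
    (d ^ 3 / 3 + (a + b) * d\<^sup>2 / 2 + a * b * d) - (c ^ 3 / 3 + (a + b) * c\<^sup>2 / 2 + a * b * c)) {c..d}"
proof (rule fundamental_theorem_of_calculus[OF assms])
  fix x assume "x \<in> {c..d}"
  have "((\<lambda>x. x ^ 3 / 3 + (a + b) * x\<^sup>2 / 2 + a * b * x) has_real_derivative (x + a) * (x + b)) (at x)"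
    by (auto intro!: derivative_eq_intros simp: field_simps power2_eq_square)
  then show "((\<lambda>x. x ^ 3 / 3 + (a + b) * x\<^sup>2 / 2 + a * b * x) has_vector_derivative (x + a) * (x + b))
      (at x within {c..d})"
    by (simp add: has_real_derivative_iff_has_vector_derivative has_vector_derivative_at_within)
qed

text \<open>The sawtooths jump at \<open>L - a\<close> and \<open>L - b\<close>, which cut the
  period into three pieces with both factors affine.\<close>

lemma has_integral_frac_mult_frac_aux:
  fixes L a b :: real
  assumes L: "L > 0" and ab: "0 \<le> b" "b \<le> a" "a < L"
  shows "((\<lambda>x. frac ((x + a) / L) * frac ((x + b) / L)) has_integral (L / 3 - L / 2 * hat ((a - b) / L))) {0..L}"
proof -
  let ?G = "\<lambda>a b x::real. x ^ 3 / 3 + (a + b) * x\<^sup>2 / 2 + a * b * x"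
  \<comment> \<open>\<open>m\<close> and \<open>n\<close> are the constant floors of the two
    arguments on the piece; they may jump at the right end \<open>d\<close>.\<close>
  have piece: "((\<lambda>x. frac ((x + a) / L) * frac ((x + b) / L)) has_integral
      (?G (a - L * of_int m) (b - L * of_int n) d - ?G (a - L * of_int m) (b - L * of_int n) c) / L\<^sup>2) {c..d}"
    if "c \<le> d" "L * of_int m \<le> c + a" "d + a \<le> L * of_int m + L"
      "L * of_int n \<le> c + b" "d + b \<le> L * of_int n + L" for c d and m n :: int
  proof (rule has_integral_spike_finite[where S="{d}"])
    show "((\<lambda>x. (x + (a - L * of_int m)) * (x + (b - L * of_int n)) / L\<^sup>2) has_integral
      (?G (a - L * of_int m) (b - L * of_int n) d - ?G (a - L * of_int m) (b - L * of_int n) c) / L\<^sup>2) {c..d}"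
      by (intro has_integral_divide has_integral_product_linear that)
    fix x assume x: "x \<in> {c..d} - {d}"
    have fl: "frac ((x + e) / L) = (x + (e - L * of_int k)) / L"
      if "L * of_int k \<le> c + e" "d + e \<le> L * of_int k + L" for e k
    proof -
      have "L * of_int k \<le> x + e" "x + e < L * of_int k + L" using that x by auto
      then have "of_int k \<le> (x + e) / L" "(x + e) / L < of_int k + 1"
        using L by (auto simp: field_simps)
      then have "\<lfloor>(x + e) / L\<rfloor> = k" by (simp add: floor_eq_iff)
      then show ?thesis using L by (simp add: frac_def field_simps)
    qed
    show "frac ((x + a) / L) * frac ((x + b) / L)
        = (x + (a - L * of_int m)) * (x + (b - L * of_int n)) / L\<^sup>2"
      using that by (simp add: fl power2_eq_square)
  qed simp
  let ?f = "\<lambda>x. frac ((x + a) / L) * frac ((x + b) / L)"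
  have 1: "(?f has_integral (?G a b (L - a) - ?G a b 0) / L\<^sup>2) {0..L - a}"
    using piece[of 0 "L - a" 0 0] ab by simp
  have 2: "(?f has_integral (?G (a - L) b (L - b) - ?G (a - L) b (L - a)) / L\<^sup>2) {L - a..L - b}"
    using piece[of "L - a" "L - b" 1 0] ab by simp
  have 3: "(?f has_integral (?G (a - L) (b - L) L - ?G (a - L) (b - L) (L - b)) / L\<^sup>2) {L - b..L}"
    using piece[of "L - b" L 1 1] ab by simp
  have "(?f has_integral (?G a b (L - a) - ?G a b 0) / L\<^sup>2 + (?G (a - L) b (L - b) - ?G (a - L) b (L - a)) / L\<^sup>2
     + (?G (a - L) (b - L) L - ?G (a - L) (b - L) (L - b)) / L\<^sup>2) {0..L}"
    using ab by (intro has_integral_combine[OF _ _ has_integral_combine[OF _ _ 1 2] 3]) auto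
  moreover have "(?G a b (L - a) - ?G a b 0) / L\<^sup>2 + (?G (a - L) b (L - b) - ?G (a - L) b (L - a)) / L\<^sup>2
     + (?G (a - L) (b - L) L - ?G (a - L) (b - L) (L - b)) / L\<^sup>2
     = L / 3 - L / 2 * ((a - b) / L * (1 - (a - b) / L))"
  proof -
    \<comment> \<open>The factor 6 clears the denominators 3 and 2 of the primitive and leaves a
      polynomial identity.\<close>
    have "6 * ((?G a b (L - a) - ?G a b 0) + (?G (a - L) b (L - b) - ?G (a - L) b (L - a))
     + (?G (a - L) (b - L) L - ?G (a - L) (b - L) (L - b)))
     = 2 * L ^ 3 - 3 * L * (a - b) * (L - (a - b))"
      by (simp add: field_simps power2_eq_square power3_eq_cube)
    moreover have "P / L\<^sup>2 + Q / L\<^sup>2 + R / L\<^sup>2 = c / 6 / L\<^sup>2" if "6 * (P + Q + R) = c" for P Q R c :: real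
    proof -
      have "c / 6 = P + Q + R" using that by simp
      then show ?thesis by (simp only: add_divide_distrib)
    qed
    ultimately have "(?G a b (L - a) - ?G a b 0) / L\<^sup>2 + (?G (a - L) b (L - b) - ?G (a - L) b (L - a)) / L\<^sup>2
     + (?G (a - L) (b - L) L - ?G (a - L) (b - L) (L - b)) / L\<^sup>2 = (2 * L ^ 3 - 3 * L * (a - b) * (L - (a - b))) / 6 / L\<^sup>2"
      by blast
    also have "\<dots> = L / 3 - L / 2 * ((a - b) / L * (1 - (a - b) / L))"
      using L by (simp add: field_simps power2_eq_square power3_eq_cube)
    finally show ?thesis .
  qed
  moreover have "hat ((a - b) / L) = (a - b) / L * (1 - (a - b) / L)"
    using ab L by (intro hat_eq) auto
  ultimately show ?thesis by simp
qed

text \<open>Everything depends on \<open>a\<close> and \<open>b\<close> only modulo \<open>L\<close>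
  and is symmetric in them, which reduces to \<open>0 \<le> b \<le> a < L\<close>.\<close>

lemma has_integral_frac_mult_frac:
  fixes L a b :: real
  assumes L: "L > 0"
  shows "((\<lambda>x. frac ((x + a) / L) * frac ((x + b) / L)) has_integral (L / 3 - L / 2 * hat ((a - b) / L))) {0..L}"
proof -
  define a' b' where "a' = L * frac (a / L)" and "b' = L * frac (b / L)"
  have bd: "0 \<le> a'" "a' < L" "0 \<le> b'" "b' < L"
    using L by (auto simp: a'_def b'_def frac_lt_1)
  have a: "(x + a) / L = (x + a') / L + of_int \<lfloor>a / L\<rfloor>" and b: "(x + b) / L = (x + b') / L + of_int \<lfloor>b / L\<rfloor>" for x
    using L by (simp_all add: a'_def b'_def frac_def field_simps)
  have "(a - b) / L = (a' - b') / L + of_int (\<lfloor>a / L\<rfloor> - \<lfloor>b / L\<rfloor>)"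
    using a[of 0] b[of 0] by (simp add: diff_divide_distrib)
  then have h: "hat ((a - b) / L) = hat ((a' - b') / L)" by (simp only: hat_of_int_add)
  have f: "frac ((x + a) / L) = frac ((x + a') / L)" "frac ((x + b) / L) = frac ((x + b') / L)" for x
    unfolding a b by simp_all
  show ?thesis
  proof (cases "b' \<le> a'")
    case True
    then show ?thesis unfolding f h using has_integral_frac_mult_frac_aux[OF L] bd by simp
  next
    case False
    have "hat ((a' - b') / L) = hat ((b' - a') / L)"
      by (metis hat_minus minus_diff_eq minus_divide_left)
    then show ?thesis unfolding f h using has_integral_frac_mult_frac_aux[OF L, of a' b'] False bd
      by (simp add: mult.commute)
  qed
qed

text \<open>This is the integral over one period of the product of the \<open>z\<close>-increments
  of two sawtooths whose jumps are \<open>r\<close> apart; the constants \<open>L / 3\<close> of the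
  autocorrelation cancel.\<close>

definition pair_kernel :: "real \<Rightarrow> real \<Rightarrow> real \<Rightarrow> real" where
  "pair_kernel L r z = L / 2 * (hat ((r + z) / L) + hat ((r - z) / L) - 2 * hat (r / L))"

text \<open>With \<open>p = 1 + 2 * s\<close> this is the \<Phi> of the overview.\<close>

definition interaction :: "real \<Rightarrow> real \<Rightarrow> real \<Rightarrow> real" where
  "interaction L p r = (LINT z|lborel. pair_kernel L r z / \<bar>z\<bar> powr p)"

lemma has_integral_saw_potential_increment:
  fixes X :: "real ^ 'n"
  shows "((\<lambda>x. (saw_potential X x - saw_potential X (x + z))\<^sup>2) has_integral
    (\<Sum>i\<in>UNIV. \<Sum>j\<in>UNIV. pair_kernel (real CARD('n)) (X $ i - X $ j) z)) {0..real CARD('n)}"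
proof -
  let ?L = "real CARD('n)"
  let ?w = "\<lambda>x c. frac ((x + c) / ?L)"
  have L: "?L > 0" by simp
  have sq: "(saw_potential X x - saw_potential X (x + z))\<^sup>2 =
    (\<Sum>i\<in>UNIV. \<Sum>j\<in>UNIV. ?w x (- X $ i) * ?w x (- X $ j) - ?w x (- X $ i) * ?w x (z - X $ j)
      - ?w x (z - X $ i) * ?w x (- X $ j) + ?w x (z - X $ i) * ?w x (z - X $ j))" for x
  proof -
    have "saw_potential X x - saw_potential X (x + z) = (\<Sum>i\<in>UNIV. ?w x (- X $ i) - ?w x (z - X $ i))"
      by (simp add: saw_potential_def sum_subtractf algebra_simps)
    then show ?thesis
      by (simp add: power2_eq_square sum_product algebra_simps)
  qed
  have int: "((\<lambda>x. ?w x (- X $ i) * ?w x (- X $ j) - ?w x (- X $ i) * ?w x (z - X $ j)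
      - ?w x (z - X $ i) * ?w x (- X $ j) + ?w x (z - X $ i) * ?w x (z - X $ j)) has_integral
      pair_kernel ?L (X $ i - X $ j) z) {0..?L}" for i j
  proof -
    let ?B = "\<lambda>a b. ?L / 3 - ?L / 2 * hat ((a - b) / ?L)"
    have "((\<lambda>x. ?w x (- X $ i) * ?w x (- X $ j) - ?w x (- X $ i) * ?w x (z - X $ j)
      - ?w x (z - X $ i) * ?w x (- X $ j) + ?w x (z - X $ i) * ?w x (z - X $ j)) has_integral
      (?B (- X $ i) (- X $ j) - ?B (- X $ i) (z - X $ j) - ?B (z - X $ i) (- X $ j) + ?B (z - X $ i) (z - X $ j))) {0..?L}"
      by (intro has_integral_add has_integral_diff has_integral_frac_mult_frac L)
    moreover have "hat ((- X $ i - - X $ j) / ?L) = hat ((X $ i - X $ j) / ?L)"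
      "hat ((z - X $ i - (z - X $ j)) / ?L) = hat ((X $ i - X $ j) / ?L)"
      "hat ((- X $ i - (z - X $ j)) / ?L) = hat ((X $ i - X $ j + z) / ?L)"
      "hat ((z - X $ i - - X $ j) / ?L) = hat ((X $ i - X $ j - z) / ?L)"
      by (subst hat_minus[symmetric], rule arg_cong[where f=hat], simp add: field_simps)+
    ultimately show ?thesis by (simp add: pair_kernel_def algebra_simps)
  qed
  show ?thesis unfolding sq by (intro has_integral_sum finite int)
qed

text \<open>Subadditivity of \<open>hat\<close> bounds both first differences by
  \<open>hat (z / L)\<close>. The bound is uniform in \<open>r\<close> and of order
  \<open>\<bar>z\<bar>\<close> at 0.\<close>

lemma abs_pair_kernel_le:
  assumes "L > 0" shows "\<bar>pair_kernel L r z\<bar> \<le> L * hat (z / L)"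
proof -
  have "\<bar>hat (r / L + z / L) - hat (r / L)\<bar> \<le> hat (z / L)" "\<bar>hat (r / L + (- (z / L))) - hat (r / L)\<bar> \<le> hat (z / L)"
    using abs_hat_diff_le[of "r / L" "z / L"] abs_hat_diff_le[of "r / L" "- (z / L)"]
    by (simp_all only: hat_minus)
  then have "\<bar>hat ((r + z) / L) + hat ((r - z) / L) - 2 * hat (r / L)\<bar> \<le> 2 * hat (z / L)"
    unfolding add_divide_distrib diff_divide_distrib add_uminus_conv_diff by linarith
  then have "L / 2 * \<bar>hat ((r + z) / L) + hat ((r - z) / L) - 2 * hat (r / L)\<bar> \<le> L / 2 * (2 * hat (z / L))"
    using assms by (intro mult_left_mono) auto
  then show ?thesis using assms by (simp add: pair_kernel_def abs_mult)
qed

section \<open>Integrability of the pair kernel and the formula for the energy\<close>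

lemma integrable_even:
  fixes g :: "real \<Rightarrow> real"
  assumes "set_integrable lborel {0..} g" and "\<And>x. g (- x) = g x"
  shows "integrable lborel g"
proof -
  have 1: "integrable lborel (\<lambda>x. indicator {0..} x * g x)"
    using assms(1) by (simp add: set_integrable_def)
  from lborel_integrable_real_affine[OF 1, of "-1" 0]
  have 2: "integrable lborel (\<lambda>x. indicator {0..} (- x) * g x)" by (simp add: assms(2))
  have "integrable lborel (\<lambda>x. indicator {0..} x * g x + indicator {0..} (- x) * g x)"
    by (rule Bochner_Integration.integrable_add[OF 1 2])
  then show ?thesis
  proof (rule integrable_cong_AE_imp)
    have [measurable]: "(\<lambda>x. indicator {0..} x * g x + indicator {0..} (- x) * g x) \<in> borel_measurable lborel"
      using 1 2 by auto
    \<comment> \<open>At 0 both indicators are 1 and would count \<open>g 0\<close> twice.\<close>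
    have "g = (\<lambda>x. if x = 0 then g 0 else indicator {0..} x * g x + indicator {0..} (- x) * g x)"
      by (auto simp: fun_eq_iff indicator_def)
    also have "\<dots> \<in> borel_measurable lborel" by measurable
    finally show "g \<in> borel_measurable lborel" .
    show "AE x in lborel. indicator {0..} x * g x + indicator {0..} (- x) * g x = g x"
      using AE_lborel_singleton[of 0] by eventually_elim (auto simp: indicator_def)
  qed
qed

lemma set_integrable_powr_to_inf:
  assumes "e < (-1::real)" "a > 0"
  shows "set_integrable lborel {a..} (\<lambda>x. x powr e)"
proof -
  have "(\<lambda>x. x powr e) absolutely_integrable_on {a..}"
    using has_integral_powr_to_inf[OF assms] by (intro nonnegative_absolutely_integrable_1) (auto simp: integrable_on_def)
  then show ?thesis
    unfolding set_integrable_def by (subst (asm) integrable_completion) auto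
qed

lemma set_integrable_powr_from_0:
  assumes "e > (-1::real)" "a \<ge> 0"
  shows "set_integrable lborel {0..a} (\<lambda>x. x powr e)"
proof -
  have "(\<lambda>x. x powr e) absolutely_integrable_on {0..a}"
    using integrable_on_powr_from_0[OF assms] by (intro nonnegative_absolutely_integrable_1) auto
  then show ?thesis
    unfolding set_integrable_def by (subst (asm) integrable_completion) auto
qed

text \<open>Near 0 the bound \<open>hat t \<le> \<bar>t\<bar>\<close> leaves
  \<open>z powr (1 - p)\<close>, integrable as \<open>p < 2\<close>; at infinity
  \<open>hat \<le> 1\<close> leaves \<open>L * z powr (- p)\<close>, integrable as
  \<open>p > 1\<close>.\<close>

lemma integrable_hat_div_powr:
  assumes L: "L > 0" and p: "1 < p" "p < 2"
  shows "integrable lborel (\<lambda>z. L * hat (z / L) / \<bar>z\<bar> powr p)"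
proof (rule integrable_even)
  have "set_integrable lborel {0..1} (\<lambda>z. z powr (1 - p))"
    using p by (intro set_integrable_powr_from_0) auto
  moreover have "set_integrable lborel {1..} (\<lambda>z. L * z powr (- p))"
    using p by (intro set_integrable_mult_right set_integrable_powr_to_inf) auto
  ultimately have "integrable lborel (\<lambda>z. indicator {0..1} z * z powr (1 - p) + indicator {1..} z * (L * z powr (- p)))"
    by (auto simp: set_integrable_def)
  then show "set_integrable lborel {0..} (\<lambda>z. L * hat (z / L) / \<bar>z\<bar> powr p)"
    unfolding set_integrable_def
  proof (rule Bochner_Integration.integrable_bound)
    show "AE z in lborel. norm (indicat_real {0..} z *\<^sub>R (L * hat (z / L) / \<bar>z\<bar> powr p))
      \<le> norm (indicat_real {0..1} z * z powr (1 - p) + indicat_real {1..} z * (L * z powr - p))"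
    proof (intro AE_I2)
      fix z :: real
      have 1: "L * hat (z / L) / \<bar>z\<bar> powr p \<le> z powr (1 - p)" if "0 < z"
      proof -
        have "L * hat (z / L) \<le> L * \<bar>z / L\<bar>" using hat_le_abs[of "z / L"] L by (intro mult_left_mono) auto
        then have "L * hat (z / L) \<le> z" using L that by simp
        then have "L * hat (z / L) / \<bar>z\<bar> powr p \<le> z / z powr p" using that by (simp add: divide_right_mono)
        also have "\<dots> = z powr (1 - p)" using that by (simp add: powr_diff)
        finally show ?thesis .
      qed
      have 2: "L * hat (z / L) / \<bar>z\<bar> powr p \<le> L * z powr (- p)" if "0 < z"
      proof -
        have "L * hat (z / L) \<le> L * 1" using hat_le_1 L by (intro mult_left_mono) auto
        then show ?thesis using that by (simp add: powr_minus divide_simps)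
      qed
      have nn: "0 \<le> L * hat (z / L) / \<bar>z\<bar> powr p" "0 \<le> z powr (1 - p)" "0 \<le> L * z powr (- p)"
        using L hat_nonneg by auto
      show "norm (indicat_real {0..} z *\<^sub>R (L * hat (z / L) / \<bar>z\<bar> powr p))
      \<le> norm (indicat_real {0..1} z * z powr (1 - p) + indicat_real {1..} z * (L * z powr - p))"
      proof (cases "z > 0")
        case False
        then show ?thesis by (cases "z = 0") (auto simp: hat_def)
      next
        case True
        then show ?thesis using 1 2 nn by (cases "z \<le> 1"; cases "z = 1"; simp)
      qed
    qed
  qed measurable
qed simp

lemma integrable_pair_kernel:
  assumes "L > 0" "1 < p" "p < 2"
  shows "integrable lborel (\<lambda>z. pair_kernel L r z / \<bar>z\<bar> powr p)"
proof (rule Bochner_Integration.integrable_bound[OF integrable_hat_div_powr[OF assms]])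
  show "AE z in lborel. norm (pair_kernel L r z / \<bar>z\<bar> powr p) \<le> norm (L * hat (z / L) / \<bar>z\<bar> powr p)"
    using abs_pair_kernel_le[OF assms(1)] assms(1) hat_nonneg
    by (intro AE_I2) (auto simp: abs_mult divide_right_mono)
qed (unfold pair_kernel_def, measurable)

text \<open>Substituting \<open>y = x + z\<close> and integrating over \<open>x\<close> first
  leaves, for each \<open>z\<close>, the squared increment over one period, which the sawtooth
  potential expresses by pair kernels.\<close>

lemma energy_eq_sum_interaction:
  fixes X :: "real ^ 'n"
  assumes "0 < s" "s < 1 / 2"
  shows "energy s X = 1 / 2 * (\<Sum>i\<in>UNIV. \<Sum>j\<in>UNIV. interaction (real CARD('n)) (1 + 2 * s) (X $ i - X $ j))"
proof -
  let ?L = "real CARD('n)" and ?p = "1 + 2 * s"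
  define u v where "u = potential X" and "v = saw_potential X"
  have p: "1 < ?p" "?p < 2" using assms by auto
  have v: "is_potential X v" unfolding v_def by (rule is_potential_saw_potential)
  then have u: "is_potential X u" unfolding u_def potential_def by (rule someI[of "is_potential X"])
  have [measurable]: "u \<in> borel_measurable borel" "v \<in> borel_measurable borel"
    using u v by (auto simp: is_potential_def)
  let ?S = "\<lambda>z. \<Sum>i\<in>UNIV. \<Sum>j\<in>UNIV. pair_kernel ?L (X $ i - X $ j) z"
  have "(\<integral>\<^sup>+ y. ennreal (\<bar>u x - u y\<bar>\<^sup>2 / \<bar>x - y\<bar> powr ?p) \<partial>lborel)
      = (\<integral>\<^sup>+ z. ennreal (\<bar>u x - u (x + z)\<bar>\<^sup>2 / \<bar>z\<bar> powr ?p) \<partial>lborel)" for x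
    by (subst nn_integral_real_affine[of _ 1 x]) auto
  then have "(\<integral>\<^sup>+ x \<in> {0..?L}. (\<integral>\<^sup>+ y. ennreal (\<bar>u x - u y\<bar>\<^sup>2 / \<bar>x - y\<bar> powr ?p) \<partial>lborel) \<partial>lborel)
     = (\<integral>\<^sup>+ x \<in> {0..?L}. (\<integral>\<^sup>+ z. ennreal (\<bar>u x - u (x + z)\<bar>\<^sup>2 / \<bar>z\<bar> powr ?p) \<partial>lborel) \<partial>lborel)"
    by (simp only:)
  also have "\<dots> = (\<integral>\<^sup>+ x. (\<integral>\<^sup>+ z. ennreal (\<bar>u x - u (x + z)\<bar>\<^sup>2 / \<bar>z\<bar> powr ?p) * indicator {0..?L} x \<partial>lborel) \<partial>lborel)"
    by (simp add: nn_integral_multc)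
  \<comment> \<open>With \<open>z\<close> outside, the chosen potential can be replaced by the
    sawtooth one for each \<open>z\<close> separately.\<close>
  also have "\<dots> = (\<integral>\<^sup>+ z. (\<integral>\<^sup>+ x. ennreal (\<bar>u x - u (x + z)\<bar>\<^sup>2 / \<bar>z\<bar> powr ?p) * indicator {0..?L} x \<partial>lborel) \<partial>lborel)"
    by (rule lborel_pair.Fubini'[symmetric]) measurable
  also have "\<dots> = (\<integral>\<^sup>+ z. ennreal (?S z / \<bar>z\<bar> powr ?p) \<partial>lborel)"
  proof (intro nn_integral_cong)
    fix z :: real
    have "AE x in lborel. \<bar>u x - u (x + z)\<bar>\<^sup>2 = (v x - v (x + z))\<^sup>2"
      using potential_diff_AE[OF u v, of z]
      by eventually_elim (metis power2_abs power2_commute)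
    then have "(\<integral>\<^sup>+ x. ennreal (\<bar>u x - u (x + z)\<bar>\<^sup>2 / \<bar>z\<bar> powr ?p) * indicator {0..?L} x \<partial>lborel)
      = (\<integral>\<^sup>+ x. ennreal ((v x - v (x + z))\<^sup>2 / \<bar>z\<bar> powr ?p) * indicator {0..?L} x \<partial>lborel)"
      by (intro nn_integral_cong_AE) (auto elim!: eventually_mono simp del: power2_abs)
    also have "\<dots> = ennreal (?S z / \<bar>z\<bar> powr ?p)"
      using has_integral_divide[OF has_integral_saw_potential_increment[of X z], of "\<bar>z\<bar> powr ?p"]
      by (intro nn_integral_has_integral_lebesgue') (auto simp: v_def)
    finally show "(\<integral>\<^sup>+ x. ennreal (\<bar>u x - u (x + z)\<bar>\<^sup>2 / \<bar>z\<bar> powr ?p) * indicator {0..?L} x \<partial>lborel)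
      = ennreal (?S z / \<bar>z\<bar> powr ?p)" .
  qed
  also have "\<dots> = ennreal (LINT z|lborel. ?S z / \<bar>z\<bar> powr ?p)"
  proof (rule nn_integral_eq_integral)
    show "integrable lborel (\<lambda>z. ?S z / \<bar>z\<bar> powr ?p)"
      unfolding sum_divide_distrib
      by (intro Bochner_Integration.integrable_sum integrable_pair_kernel p) auto
    \<comment> \<open>A single pair kernel can be negative, but the double sum is the integral of a
      square.\<close>
    have "0 \<le> ?S z" for z
      by (rule has_integral_nonneg[OF has_integral_saw_potential_increment[of X z]]) simp
    then show "AE z in lborel. 0 \<le> ?S z / \<bar>z\<bar> powr ?p" by simp
  qed
  finally have "energy s X = 1 / 2 * enn2real (ennreal (LINT z|lborel. ?S z / \<bar>z\<bar> powr ?p))"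
    unfolding energy_def u_def by simp
  also have "enn2real (ennreal (LINT z|lborel. ?S z / \<bar>z\<bar> powr ?p)) = (LINT z|lborel. ?S z / \<bar>z\<bar> powr ?p)"
  proof (rule enn2real_ennreal, rule Bochner_Integration.integral_nonneg)
    show "0 \<le> ?S z / \<bar>z\<bar> powr ?p" for z
      using has_integral_nonneg[OF has_integral_saw_potential_increment[of X z]] by simp
  qed
  also have "\<dots> = (\<Sum>i\<in>UNIV. \<Sum>j\<in>UNIV. interaction ?L ?p (X $ i - X $ j))"
  proof -
    have I: "integrable lborel (\<lambda>z. pair_kernel ?L r z / \<bar>z\<bar> powr ?p)" for r
      by (rule integrable_pair_kernel[OF _ p]) simp
    show ?thesis
      unfolding sum_divide_distrib interaction_def
      by (simp only: Bochner_Integration.integral_sum[OF Bochner_Integration.integrable_sum[OF I]]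
          Bochner_Integration.integral_sum[OF I])
  qed
  finally show ?thesis .
qed

section \<open>The slope of the pair interaction\<close>

text \<open>On \<open>(0,L)\<close> the derivative of \<open>pair_kernel L\<close> with respect to \<open>r\<close> is \<open>crossings L r z\<close>, which vanishes
  for small \<open>z\<close>. So for \<open>r\<close> in \<open>[d, L - d]\<close> truncating the kernel at \<open>d\<close> does not change the slope of the
  interaction, but makes it Lipschitz on the whole line.\<close>

definition crossings :: "real \<Rightarrow> real \<Rightarrow> real \<Rightarrow> real" where
  "crossings L r z = of_int \<lfloor>(r + z) / L\<rfloor> + of_int \<lfloor>(r - z) / L\<rfloor>"

definition trunc_kernel :: "real \<Rightarrow> real \<Rightarrow> real \<Rightarrow> real" where
  "trunc_kernel d p z = max \<bar>z\<bar> d powr (- p)"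

definition trunc_slope :: "real \<Rightarrow> real \<Rightarrow> real \<Rightarrow> real \<Rightarrow> real" where
  "trunc_slope L p d r = (LINT z|lborel. crossings L r z * trunc_kernel d p z)"

lemma trunc_kernel_nonneg [simp]: "0 \<le> trunc_kernel d p z"
  and trunc_kernel_minus [simp]: "trunc_kernel d p (- z) = trunc_kernel d p z"
  by (simp_all add: trunc_kernel_def)

section \<open>Regularity and symmetry of the truncated slope\<close>

lemma trunc_kernel_antimono:
  assumes "\<bar>z\<bar> \<le> \<bar>w\<bar>" "d > 0" "p > 0"
  shows "trunc_kernel d p w \<le> trunc_kernel d p z"
  unfolding trunc_kernel_def using assms by (intro powr_mono2') auto

lemma borel_measurable_trunc_kernel [measurable]: "trunc_kernel d p \<in> borel_measurable borel"
  unfolding trunc_kernel_def by measurable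

lemma borel_measurable_crossings [measurable]: "crossings L r \<in> borel_measurable borel"
  unfolding crossings_def by measurable

lemma integrable_trunc_kernel:
  assumes d: "d > 0" and p: "p > 1"
  shows "integrable lborel (trunc_kernel d p)"
proof (rule integrable_even)
  have "set_integrable lborel {d..} (\<lambda>z. z powr (- p))"
    using p d by (intro set_integrable_powr_to_inf) auto
  moreover have "integrable lborel (\<lambda>z. indicator {0..d} z * (d powr (- p)))"
    by (intro integrable_mult_left integrable_real_indicator) (auto simp: emeasure_lborel_Icc_eq)
  ultimately have "integrable lborel (\<lambda>z. indicator {0..d} z * (d powr (- p)) + indicator {d..} z * z powr (- p))"
    by (auto simp: set_integrable_def)
  then show "set_integrable lborel {0..} (trunc_kernel d p)"
    unfolding set_integrable_def
  proof (rule Bochner_Integration.integrable_bound)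
    show "AE z in lborel. norm (indicat_real {0..} z *\<^sub>R trunc_kernel d p z)
      \<le> norm (indicat_real {0..d} z * d powr - p + indicat_real {d..} z * z powr - p)"
      using d by (intro AE_I2) (auto simp: indicator_def trunc_kernel_def max_def)
  qed measurable
qed simp

text \<open>The kernel is even and nonincreasing in \<open>\<bar>z\<bar>\<close>, so the difference
  is nonnegative for \<open>z \<ge> - h / 2\<close> and nonpositive before. After a shift on both
  halves only twice the integral of the kernel over an interval of length \<open>h\<close> around 0
  remains.\<close>

lemma integral_trunc_kernel_diff_le:
  assumes d: "d > 0" and p: "p > 1" and h: "h \<ge> 0"
  shows "(LINT z|lborel. \<bar>trunc_kernel d p z - trunc_kernel d p (z + h)\<bar>) \<le> 2 * h * trunc_kernel d p 0"
proof -
  let ?k = "trunc_kernel d p"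
  have int: "integrable lborel (\<lambda>z. indicator A z * ?k z)" if "A \<in> sets borel" for A
    using that integrable_trunc_kernel[OF d p] integrable_real_mult_indicator[of A lborel ?k]
    by (simp add: mult.commute)
  have shift: "integrable lborel (\<lambda>z. indicator A (z + h) * ?k (z + h))"
    "(LINT z|lborel. indicator A (z + h) * ?k (z + h)) = (LINT z|lborel. indicator A z * ?k z)"
    if "A \<in> sets borel" for A
    using lborel_integrable_real_affine[OF int[OF that], of 1 h]
      lborel_integral_real_affine[of 1 "\<lambda>z. indicator A z * ?k z" h]
    by (simp_all add: add.commute[of h])
  have "(LINT z|lborel. \<bar>?k z - ?k (z + h)\<bar>) =
    (LINT z|lborel. indicator {- h / 2..} z * ?k z - indicator {h / 2..} (z + h) * ?k (z + h)
      + indicator {..<h / 2} (z + h) * ?k (z + h) - indicator {..<- h / 2} z * ?k z)"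
  proof (intro Bochner_Integration.integral_cong refl)
    fix z
    have "?k (z + h) \<le> ?k z" if "z \<ge> - h / 2"
      using that h d p by (intro trunc_kernel_antimono) auto
    moreover have "?k z \<le> ?k (z + h)" if "z < - h / 2"
      using that h d p by (intro trunc_kernel_antimono) auto
    ultimately show "\<bar>?k z - ?k (z + h)\<bar> = indicator {- h / 2..} z * ?k z - indicator {h / 2..} (z + h) * ?k (z + h)
      + indicator {..<h / 2} (z + h) * ?k (z + h) - indicator {..<- h / 2} z * ?k z"
      by (cases "z \<ge> - h / 2") (auto simp: indicator_def)
  qed
  also have "\<dots> = (LINT z|lborel. indicator {- h / 2..} z * ?k z) - (LINT z|lborel. indicator {h / 2..} z * ?k z)
      + (LINT z|lborel. indicator {..<h / 2} z * ?k z) - (LINT z|lborel. indicator {..<- h / 2} z * ?k z)"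
    by (simp add: int shift)
  also have "\<dots> = (LINT z|lborel. indicator {- h / 2..} z * ?k z - indicator {h / 2..} z * ?k z
      + indicator {..<h / 2} z * ?k z - indicator {..<- h / 2} z * ?k z)"
    by (simp add: int)
  also have "\<dots> = (LINT z|lborel. indicator {- h / 2..<h / 2} z * (2 * ?k z))"
    using h by (intro Bochner_Integration.integral_cong) (auto simp: indicator_def)
  also have "\<dots> \<le> (LINT z|lborel. indicator {- h / 2..<h / 2} z * (2 * ?k 0))"
  proof (rule Bochner_Integration.integral_mono)
    show "integrable lborel (\<lambda>z. indicator {- h / 2..<h / 2} z * (2 * ?k z))"
      using integrable_mult_right[OF int[of "{- h / 2..<h / 2}"], of 2] by (simp add: mult_ac)
    show "integrable lborel (\<lambda>z. indicator {- h / 2..<h / 2} z * (2 * ?k 0))"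
      by (intro integrable_mult_left integrable_real_indicator) (use h in auto)
    show "indicator {- h / 2..<h / 2} z * (2 * ?k z) \<le> indicator {- h / 2..<h / 2} z * (2 * ?k 0)" for z
      using trunc_kernel_antimono[of 0 z d p] d p by (auto simp: indicator_def)
  qed
  also have "\<dots> = 2 * h * ?k 0"
    using h by simp
  finally show ?thesis .
qed

text \<open>This separates the part that is linear in \<open>r\<close> from a bounded periodic
  one.\<close>

lemma crossings_eq_frac: "crossings L r z = 2 * (r / L) - frac ((r + z) / L) - frac ((r - z) / L)"
  by (simp add: crossings_def frac_def add_divide_distrib diff_divide_distrib)

lemma integrable_crossings:
  assumes "d > 0" "p > 1"
  shows "integrable lborel (\<lambda>z. crossings L r z * trunc_kernel d p z)"
proof (rule Bochner_Integration.integrable_bound)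
  show "integrable lborel (\<lambda>z. (2 * \<bar>r / L\<bar> + 2) * trunc_kernel d p z)"
    using integrable_trunc_kernel[OF assms] by simp
  show "AE z in lborel. norm (crossings L r z * trunc_kernel d p z) \<le> norm ((2 * \<bar>r / L\<bar> + 2) * trunc_kernel d p z)"
  proof (intro AE_I2)
    fix z
    have "\<bar>crossings L r z\<bar> \<le> 2 * \<bar>r / L\<bar> + 2"
      using frac_lt_1[of "(r + z) / L"] frac_ge_0[of "(r + z) / L"]
        frac_lt_1[of "(r - z) / L"] frac_ge_0[of "(r - z) / L"]
      unfolding crossings_eq_frac by linarith
    then show "norm (crossings L r z * trunc_kernel d p z) \<le> norm ((2 * \<bar>r / L\<bar> + 2) * trunc_kernel d p z)"
      by (auto simp: abs_mult intro!: mult_right_mono)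
  qed
qed measurable

lemma trunc_slope_mono:
  assumes "L > 0" "d > 0" "p > 1" "r \<le> r'"
  shows "trunc_slope L p d r \<le> trunc_slope L p d r'"
  unfolding trunc_slope_def
proof (rule Bochner_Integration.integral_mono)
  fix z
  have "crossings L r z \<le> crossings L r' z"
    unfolding crossings_def using assms
    by (intro add_mono of_int_le_iff[THEN iffD2] floor_mono divide_right_mono) auto
  then show "crossings L r z * trunc_kernel d p z \<le> crossings L r' z * trunc_kernel d p z"
    by (intro mult_right_mono) auto
qed (use assms in \<open>simp_all add: integrable_crossings\<close>)

text \<open>For fixed \<open>z\<close> the function \<open>crossings\<close> jumps in
  \<open>r\<close>. Translating the integration variable moves \<open>r\<close> from
  \<open>frac\<close> into the kernel, whose translates depend on the shift in a Lipschitz way in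
  the integral norm. The first summand of the constant comes from the linear part, the second one
  from the two \<open>frac\<close> terms.\<close>

lemma trunc_slope_lipschitz:
  assumes L: "L > 0" and d: "d > 0" and p: "p > 1"
  shows "\<bar>trunc_slope L p d r - trunc_slope L p d r'\<bar>
    \<le> (2 / L * (LINT z|lborel. trunc_kernel d p z) + 4 * trunc_kernel d p 0) * \<bar>r - r'\<bar>"
proof -
  let ?k = "trunc_kernel d p"
  define J where "J = (\<lambda>r. LINT z|lborel. frac ((r + z) / L) * ?k z)"
  have k: "integrable lborel ?k" by (rule integrable_trunc_kernel[OF d p])
  have fr: "\<bar>frac t\<bar> \<le> 1" for t :: real using frac_lt_1[of t] frac_ge_0[of t] by linarith
  have bd: "integrable lborel (\<lambda>z. frac (f z) * g z)"
    if "integrable lborel g" "f \<in> borel_measurable borel" for f g :: "real \<Rightarrow> real"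
  proof (rule Bochner_Integration.integrable_bound[OF that(1)])
    have [measurable]: "f \<in> borel_measurable borel" "g \<in> borel_measurable borel" using that by auto
    show "(\<lambda>z. frac (f z) * g z) \<in> borel_measurable lborel" by measurable
    show "AE x in lborel. norm (frac (f x) * g x) \<le> norm (g x)"
      using fr by (intro AE_I2) (auto simp: abs_mult intro!: mult_left_le_one_le)
  qed
  have J1: "integrable lborel (\<lambda>z. frac ((r + z) / L) * ?k z)"
    and J2: "integrable lborel (\<lambda>z. frac ((r - z) / L) * ?k z)" for r
    by (intro bd k; measurable)+
  \<comment> \<open>As the kernel is even, \<open>z\<close> may be replaced by \<open>- z\<close>,
    which identifies the two \<open>frac\<close> terms.\<close>
  have J2': "(LINT z|lborel. frac ((r - z) / L) * ?k z) = J r" for r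
    unfolding J_def by (subst lborel_integral_real_affine[of "-1" _ 0]) simp_all
  have slope: "trunc_slope L p d r = 2 * (r / L) * (LINT z|lborel. ?k z) - 2 * J r" for r
  proof -
    have "trunc_slope L p d r = (LINT z|lborel. 2 * (r / L) * ?k z - frac ((r + z) / L) * ?k z - frac ((r - z) / L) * ?k z)"
      unfolding trunc_slope_def crossings_eq_frac by (simp add: left_diff_distrib)
    also have "\<dots> = 2 * (r / L) * (LINT z|lborel. ?k z) - J r - (LINT z|lborel. frac ((r - z) / L) * ?k z)"
      unfolding J_def using J1[of r] J2[of r] k by simp
    finally show ?thesis by (simp add: J2')
  qed
  have J3: "J r = (LINT z|lborel. frac (z / L) * ?k (z - r))"
    and J4: "integrable lborel (\<lambda>z. frac (z / L) * ?k (z - r))"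
    and k_shift: "integrable lborel (\<lambda>z. ?k (z - r))" for r
  proof -
    show "J r = (LINT z|lborel. frac (z / L) * ?k (z - r))"
      unfolding J_def by (subst lborel_integral_real_affine[of 1 _ "- r"]) simp_all
    show "integrable lborel (\<lambda>z. ?k (z - r))"
      using lborel_integrable_real_affine[OF k, of 1 "- r"] by simp
    then show "integrable lborel (\<lambda>z. frac (z / L) * ?k (z - r))"
      by (rule bd) measurable
  qed
  have J_lip: "\<bar>J r - J r'\<bar> \<le> 2 * \<bar>r - r'\<bar> * ?k 0" if "r' \<le> r" for r r'
  proof -
    have "\<bar>J r - J r'\<bar> = \<bar>LINT z|lborel. frac (z / L) * (?k (z - r) - ?k (z - r'))\<bar>"
      unfolding J3 by (subst Bochner_Integration.integral_diff[symmetric]) (auto simp: J4 right_diff_distrib)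
    also have "\<dots> \<le> (LINT z|lborel. \<bar>?k (z - r) - ?k (z - r')\<bar>)"
    proof (rule order_trans[OF integral_abs_bound Bochner_Integration.integral_mono])
      show "integrable lborel (\<lambda>z. \<bar>?k (z - r) - ?k (z - r')\<bar>)" using k_shift by simp
      show "integrable lborel (\<lambda>z. \<bar>frac (z / L) * (?k (z - r) - ?k (z - r'))\<bar>)"
        using k_shift by (intro integrable_abs bd) auto
      show "\<bar>frac (z / L) * (?k (z - r) - ?k (z - r'))\<bar> \<le> \<bar>?k (z - r) - ?k (z - r')\<bar>" for z
        using fr[of "z / L"] by (auto simp: abs_mult intro!: mult_left_le_one_le)
    qed
    also have "\<dots> = (LINT z|lborel. \<bar>?k z - ?k (z + (r - r'))\<bar>)"
    proof -
      have E: "r + z - r = z" "r + z - r' = z + (r - r')" for z by simp_all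
      show ?thesis
        by (subst lborel_integral_real_affine[of 1 _ r]) (simp_all only: E real_scaleR_def abs_one mult_1 one_neq_zero not_False_eq_True)
    qed
    also have "\<dots> \<le> 2 * (r - r') * ?k 0"
      using that by (intro integral_trunc_kernel_diff_le d p) auto
    finally show ?thesis using that by simp
  qed
  have J_lip': "\<bar>J r - J r'\<bar> \<le> 2 * \<bar>r - r'\<bar> * ?k 0"
    using J_lip[of r' r] J_lip[of r r'] by (cases "r' \<le> r") (auto simp: abs_minus_commute)
  have nn: "0 \<le> (LINT z|lborel. ?k z)" by (intro Bochner_Integration.integral_nonneg) simp
  have tri: "a = b - 2 * c \<Longrightarrow> \<bar>a\<bar> \<le> \<bar>b\<bar> + 2 * \<bar>c\<bar>" for a b c :: real by linarith
  have "trunc_slope L p d r - trunc_slope L p d r' = 2 / L * (LINT z|lborel. ?k z) * (r - r') - 2 * (J r - J r')"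
    using L by (simp add: slope field_simps)
  then have "\<bar>trunc_slope L p d r - trunc_slope L p d r'\<bar>
      \<le> \<bar>2 / L * (LINT z|lborel. ?k z) * (r - r')\<bar> + 2 * \<bar>J r - J r'\<bar>"
    by (rule tri)
  moreover have "\<bar>2 / L * (LINT z|lborel. ?k z) * (r - r')\<bar> = 2 / L * (LINT z|lborel. ?k z) * \<bar>r - r'\<bar>"
    using L nn by (simp add: abs_mult)
  ultimately show ?thesis using J_lip' by (simp add: algebra_simps)
qed

text \<open>For \<open>t\<close> not an integer,
  \<open>\<lfloor>1 - t\<rfloor> = - \<lfloor>t\<rfloor>\<close>; the excluded values of
  \<open>z\<close> form a countable set.\<close>

lemma trunc_slope_reflect:
  assumes L: "L > 0"
  shows "trunc_slope L p d (L - r) = - trunc_slope L p d r"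
proof -
  have "AE z in lborel. z \<notin> range (\<lambda>k::int. r - L * of_int k) \<union> range (\<lambda>k::int. L * of_int k - r)"
    by (intro AE_not_in countable_imp_null_set_lborel) auto
  then have "AE z in lborel. crossings L (L - r) z = - crossings L r z"
  proof eventually_elim
    fix z assume z: "z \<notin> range (\<lambda>k::int. r - L * of_int k) \<union> range (\<lambda>k::int. L * of_int k - r)"
    have fl: "\<lfloor>1 - t\<rfloor> = - \<lfloor>t\<rfloor>" if "t \<notin> \<int>" for t :: real
    proof -
      have "of_int \<lfloor>t\<rfloor> \<noteq> t" using that by (metis Ints_of_int)
      then show ?thesis by (intro floor_unique) linarith+
    qed
    have A: "(r - z) / L \<notin> \<int>"
    proof
      assume "(r - z) / L \<in> \<int>"
      then obtain k :: int where "(r - z) / L = of_int k" by (auto elim: Ints_cases)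
      then have "z = r - L * of_int k" using L by (simp add: field_simps)
      with z show False by auto
    qed
    have B: "(r + z) / L \<notin> \<int>"
    proof
      assume "(r + z) / L \<in> \<int>"
      then obtain k :: int where "(r + z) / L = of_int k" by (auto elim: Ints_cases)
      then have "z = L * of_int k - r" using L by (simp add: field_simps)
      with z show False by auto
    qed
    have e: "(L - r + z) / L = 1 - (r - z) / L" "(L - r - z) / L = 1 - (r + z) / L"
      using L by (simp_all add: field_simps)
    show "crossings L (L - r) z = - crossings L r z"
      unfolding crossings_def e fl[OF A] fl[OF B] by simp
  qed
  then have "AE z in lborel. crossings L (L - r) z * trunc_kernel d p z = - (crossings L r z * trunc_kernel d p z)"
    by eventually_elim simp
  then have "trunc_slope L p d (L - r) = (LINT z|lborel. - (crossings L r z * trunc_kernel d p z))"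
    unfolding trunc_slope_def by (intro integral_cong_AE) auto
  then show ?thesis by (simp add: trunc_slope_def)
qed

section \<open>Convexity and differentiability of the interaction\<close>

text \<open>\<open>hat t - (t - t\<^sup>2)\<close> is the piecewise affine interpolation of
  \<open>t\<^sup>2 - t\<close> at the integers. It is convex with slope
  \<open>2 * \<lfloor>t\<rfloor>\<close>, and this is its subgradient inequality.\<close>

lemma hat_diff_ge: "hat t' - hat t \<ge> (t' - t'\<^sup>2) - (t - t\<^sup>2) + 2 * of_int \<lfloor>t\<rfloor> * (t' - t)"
proof -
  define m m' where "m = (of_int \<lfloor>t\<rfloor> :: real)" and "m' = (of_int \<lfloor>t'\<rfloor> :: real)"
  have hat: "hat t = t - t\<^sup>2 + 2 * m * t - m - m\<^sup>2" "hat t' = t' - t'\<^sup>2 + 2 * m' * t' - m' - m'\<^sup>2"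
    by (simp_all add: hat_def frac_def m_def m'_def power2_eq_square algebra_simps)
  \<comment> \<open>This product is exactly the difference of the two sides.\<close>
  have "0 \<le> (m' - m) * (2 * t' - m - m' - 1)"
  proof (cases "\<lfloor>t'\<rfloor>" "\<lfloor>t\<rfloor>" rule: linorder_cases)
    case less
    then have "\<lfloor>t'\<rfloor> + 1 \<le> \<lfloor>t\<rfloor>" by simp
    then have "m' + 1 \<le> m" unfolding m_def m'_def by linarith
    moreover have "t' \<le> m' + 1" unfolding m'_def by linarith
    ultimately show ?thesis by (intro mult_nonpos_nonpos) auto
  next
    case greater
    then have "\<lfloor>t\<rfloor> + 1 \<le> \<lfloor>t'\<rfloor>" by simp
    then have "m + 1 \<le> m'" unfolding m_def m'_def by linarith
    moreover have "t' \<ge> m'" unfolding m'_def by linarith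
    ultimately show ?thesis by (intro mult_nonneg_nonneg) auto
  qed (simp add: m_def m'_def)
  then show ?thesis unfolding hat m_def[symmetric] by (simp add: algebra_simps power2_eq_square)
qed

text \<open>In the second difference the parabola \<open>t - t\<^sup>2\<close> contributes a
  quantity independent of \<open>r\<close>. On \<open>[0,L]\<close> the middle term
  \<open>hat (r / L)\<close> is this parabola itself, so only the convex remainders at
  \<open>(r + z) / L\<close> and \<open>(r - z) / L\<close> are left.\<close>

lemma pair_kernel_subgradient:
  assumes L: "L > 0" and r: "0 \<le> r" "r \<le> L" "0 \<le> r'" "r' \<le> L"
  shows "pair_kernel L r' z - pair_kernel L r z \<ge> crossings L r z * (r' - r)"
proof -
  define a b c where "a = r / L" and "b = r' / L" and "c = z / L"
  have ab: "hat a = a - a\<^sup>2" "hat b = b - b\<^sup>2"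
    using r L by (auto simp: a_def b_def hat_eq power2_eq_square algebra_simps)
  let ?m = "of_int \<lfloor>a + c\<rfloor> :: real" and ?n = "of_int \<lfloor>a - c\<rfloor> :: real"
  have e: "(r + z) / L = a + c" "(r - z) / L = a - c" "(r' + z) / L = b + c" "(r' - z) / L = b - c"
    by (auto simp: a_def b_def c_def add_divide_distrib diff_divide_distrib)
  have "hat (b + c) - hat (a + c) + (hat (b - c) - hat (a - c)) - 2 * (hat b - hat a) \<ge> 2 * ((?m + ?n) * (b - a))"
    using hat_diff_ge[where t="a + c" and t'="b + c"] hat_diff_ge[where t="a - c" and t'="b - c"] unfolding ab
    by (simp add: power2_eq_square algebra_simps)
  then have "L / 2 * (hat (b + c) - hat (a + c) + (hat (b - c) - hat (a - c)) - 2 * (hat b - hat a))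
     \<ge> L / 2 * (2 * ((?m + ?n) * (b - a)))"
    using L by (intro mult_left_mono) auto
  moreover have "L / 2 * (2 * ((?m + ?n) * (b - a))) = (?m + ?n) * (r' - r)"
    using L by (simp add: a_def b_def field_simps)
  ultimately show ?thesis
    unfolding pair_kernel_def crossings_def e a_def[symmetric] b_def[symmetric]
    by (simp add: algebra_simps)
qed

text \<open>The pointwise inequality is integrated against \<open>\<bar>z\<bar> powr (- p)\<close>.
  Only the base point \<open>r\<close> has to keep the distance \<open>d\<close> from the
  singularities; \<open>r'\<close> ranges over the closed period.\<close>

lemma interaction_subgradient:
  assumes L: "L > 0" and p: "1 < p" "p < 2" and d: "d > 0"
    and r: "d \<le> r" "r \<le> L - d" "0 \<le> r'" "r' \<le> L"
  shows "interaction L p r' - interaction L p r \<ge> trunc_slope L p d r * (r' - r)"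
proof -
  have "trunc_slope L p d r * (r' - r) = (LINT z|lborel. crossings L r z * trunc_kernel d p z * (r' - r))"
    by (simp add: trunc_slope_def)
  also have "\<dots> \<le> (LINT z|lborel. pair_kernel L r' z / \<bar>z\<bar> powr p - pair_kernel L r z / \<bar>z\<bar> powr p)"
  proof (rule Bochner_Integration.integral_mono)
    fix z
    have "crossings L r z * trunc_kernel d p z = crossings L r z / \<bar>z\<bar> powr p"
    proof (cases "\<bar>z\<bar> < d")
      case True
      with r have "0 \<le> (r + z) / L" "(r + z) / L < 1" "0 \<le> (r - z) / L" "(r - z) / L < 1"
        using L by auto
      then have "\<lfloor>(r + z) / L\<rfloor> = 0" "\<lfloor>(r - z) / L\<rfloor> = 0" by (simp_all only: floor_eq_iff) simp_all
      then have "crossings L r z = 0" by (simp add: crossings_def)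
      then show ?thesis by simp
    next
      case False
      then show ?thesis by (simp add: trunc_kernel_def powr_minus divide_inverse max_def)
    qed
    then have "crossings L r z * trunc_kernel d p z * (r' - r) = crossings L r z * (r' - r) / \<bar>z\<bar> powr p"
      by simp
    also have "\<dots> \<le> (pair_kernel L r' z - pair_kernel L r z) / \<bar>z\<bar> powr p"
      using r d by (intro divide_right_mono pair_kernel_subgradient L) auto
    finally show "crossings L r z * trunc_kernel d p z * (r' - r)
       \<le> pair_kernel L r' z / \<bar>z\<bar> powr p - pair_kernel L r z / \<bar>z\<bar> powr p"
      by (simp add: diff_divide_distrib)
  next
    show "integrable lborel (\<lambda>z. crossings L r z * trunc_kernel d p z * (r' - r))"
      using integrable_crossings[OF d p(1)] by (intro integrable_mult_left) auto
  qed (intro Bochner_Integration.integrable_diff integrable_pair_kernel L p)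
  also have "\<dots> = interaction L p r' - interaction L p r"
    unfolding interaction_def
    by (intro Bochner_Integration.integral_diff integrable_pair_kernel L p)
  finally show ?thesis .
qed

lemma interaction_minus [simp]: "interaction L p (- r) = interaction L p r"
proof -
  have "pair_kernel L (- r) z = pair_kernel L r z" for z
  proof -
    have "(- r + z) / L = - ((r - z) / L)" "(- r - z) / L = - ((r + z) / L)" "- r / L = - (r / L)"
      unfolding minus_divide_left by simp_all
    then show ?thesis unfolding pair_kernel_def by (simp only: hat_minus) simp
  qed
  then show ?thesis by (simp add: interaction_def)
qed

text \<open>The subgradient inequalities at \<open>r\<close> and at \<open>y\<close> trap the
  difference quotient between the slopes at these points, which differ by at most
  \<open>C * \<bar>y - r\<bar>\<close>.\<close>

lemma interaction_has_derivative:
  assumes L: "L > 0" and p: "1 < p" "p < 2" and d: "d > 0" and r: "d < r" "r < L - d"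
  shows "(interaction L p has_real_derivative trunc_slope L p d r) (at r)"
proof -
  let ?F = "trunc_slope L p d" and ?\<Phi> = "interaction L p"
  obtain C where C: "\<And>r r'. \<bar>?F r - ?F r'\<bar> \<le> C * \<bar>r - r'\<bar>"
    using trunc_slope_lipschitz[OF L d p(1)] by blast
  have "((\<lambda>y. (?\<Phi> y - ?\<Phi> r) / (y - r) - ?F r) \<longlongrightarrow> 0) (at r)"
  proof (rule Lim_null_comparison)
    have "((\<lambda>y. C * \<bar>y - r\<bar>) \<longlongrightarrow> C * \<bar>r - r\<bar>) (at r)" by (intro tendsto_intros)
    then show "((\<lambda>y. C * \<bar>y - r\<bar>) \<longlongrightarrow> 0) (at r)" by simp
    have "\<forall>\<^sub>F y in at r. y \<in> {d<..<L - d}"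
      using r by (intro eventually_at_in_open') auto
    moreover have "\<forall>\<^sub>F y in at r. y \<noteq> r" by (simp add: eventually_at_filter)
    ultimately show "\<forall>\<^sub>F y in at r. norm ((?\<Phi> y - ?\<Phi> r) / (y - r) - ?F r) \<le> C * \<bar>y - r\<bar>"
    proof eventually_elim
      case (elim y)
      have 1: "?F r * (y - r) \<le> ?\<Phi> y - ?\<Phi> r"
        using elim r d by (intro interaction_subgradient L p) auto
      have 2: "?F y * (r - y) \<le> ?\<Phi> r - ?\<Phi> y"
        using elim r d by (intro interaction_subgradient L p) auto
      have "\<bar>?\<Phi> y - ?\<Phi> r - ?F r * (y - r)\<bar> \<le> (?F y - ?F r) * (y - r)"
        using 1 2 by (simp add: algebra_simps abs_le_iff)
      also have "\<dots> \<le> \<bar>?F y - ?F r\<bar> * \<bar>y - r\<bar>" by (metis abs_ge_self abs_mult)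
      also have "\<dots> \<le> (C * \<bar>y - r\<bar>) * \<bar>y - r\<bar>" by (intro mult_right_mono C) simp
      finally have "\<bar>?\<Phi> y - ?\<Phi> r - ?F r * (y - r)\<bar> / \<bar>y - r\<bar> \<le> C * \<bar>y - r\<bar>"
        using elim by (simp add: pos_divide_le_eq)
      moreover have "(?\<Phi> y - ?\<Phi> r) / (y - r) - ?F r = (?\<Phi> y - ?\<Phi> r - ?F r * (y - r)) / (y - r)"
        using elim by (simp add: field_simps)
      ultimately show ?case by (simp add: abs_divide)
    qed
  qed
  then show ?thesis by (simp add: has_field_derivative_iff LIM_zero_iff)
qed

section \<open>Global solutions of Lipschitz equations\<close>

lemma has_integral_exp_mult:
  fixes c :: real assumes "c > 0" "t \<ge> 0"
  shows "((\<lambda>x. exp (c * x)) has_integral (exp (c * t) - 1) / c) {0..t}"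
proof -
  have "((\<lambda>x. exp (c * x)) has_integral exp (c * t) / c - exp (c * 0) / c) {0..t}"
  proof (rule fundamental_theorem_of_calculus[OF assms(2)])
    fix x
    have "((\<lambda>x. exp (c * x) / c) has_real_derivative exp (c * x)) (at x)"
      using assms by (auto intro!: derivative_eq_intros)
    then show "((\<lambda>x. exp (c * x) / c) has_vector_derivative exp (c * x)) (at x within {0..t})"
      by (simp add: has_real_derivative_iff_has_vector_derivative has_vector_derivative_at_within)
  qed
  then show ?thesis by (simp add: diff_divide_distrib)
qed

text \<open>The Picard operator is a contraction for a norm with an exponential weight in time, which
  gives the solution on the whole half-line at once.\<close>

theorem lipschitz_ode_global_solution:
  fixes f :: "'a::euclidean_space \<Rightarrow> 'a"
  assumes lip: "\<And>x y. norm (f x - f y) \<le> K * norm (x - y)" and K: "K > 0"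
  obtains y where "y 0 = y0" "\<And>t. t \<ge> 0 \<Longrightarrow> (y has_vector_derivative f (y t)) (at t within {0..})"
proof -
  \<comment> \<open>The operator has Lipschitz constant \<open>K / c = 1 / 2\<close> for the weight
    \<open>exp (- c * t)\<close>.\<close>
  define c where "c = 2 * K"
  have c: "c > 0" using K by (simp add: c_def)
  \<comment> \<open>The unknown \<open>w\<close> is the weighted increment
    \<open>exp (- c * t) *\<^sub>R (y t - y0)\<close>, sought in the complete space of bounded
    continuous functions.\<close>
  define lift where "lift = (\<lambda>(w :: real \<Rightarrow>\<^sub>C 'a) x. y0 + exp (c * x) *\<^sub>R apply_bcontfun w x)"
  have f_cont: "continuous_on UNIV f"
  proof (rule continuous_on_iff[THEN iffD2], intro ballI allI impI)
    fix x :: 'a and e :: real assume "e > 0"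
    then show "\<exists>d>0. \<forall>x'\<in>UNIV. dist x' x < d \<longrightarrow> dist (f x') (f x) < e"
      using K lip by (intro exI[of _ "e / K"])
        (auto simp: dist_norm pos_less_divide_eq mult.commute intro: le_less_trans)
  qed
  have lift_cont: "continuous_on S (\<lambda>x. f (lift w x))" for w S
    unfolding lift_def by (intro continuous_on_compose2[OF f_cont] continuous_intros) auto
  \<comment> \<open>\<open>max 0 t\<close> extends the integral to negative times, since elements of
    this space are defined on all reals.\<close>
  define G where "G = (\<lambda>w t. integral {0..max 0 t} (\<lambda>x. f (lift w x)))"
  define P where "P = (\<lambda>w t. exp (- c * max 0 t) *\<^sub>R G w t)"
  have int: "(\<lambda>x. f (lift w x)) integrable_on {0..t}" for w t
    by (intro integrable_continuous_real lift_cont)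
  have D: "((\<lambda>t. integral {0..t} (\<lambda>x. f (lift w x))) has_vector_derivative f (lift w t)) (at t within {0..})"
    if "t \<ge> 0" for w t
  proof -
    have "((\<lambda>t. integral {0..t} (\<lambda>x. f (lift w x))) has_vector_derivative f (lift w t)) (at t within {0..t + 1})"
      using that by (intro integral_has_vector_derivative lift_cont) auto
    moreover have "at t within {0..t + 1} = at t within {0..}"
      by (rule at_within_nhd[of t "{..<t + 1}"]) auto
    ultimately show ?thesis by simp
  qed
  have G_cont: "continuous_on UNIV (G w)" for w
  proof -
    have "continuous_on {0..} (\<lambda>t. integral {0..t} (\<lambda>x. f (lift w x)))"
      using D has_vector_derivative_continuous
      by (fastforce simp: continuous_on_eq_continuous_within)
    then show ?thesis unfolding G_def
      by (rule continuous_on_compose2) (auto intro!: continuous_intros)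
  qed
  have exp_int: "integral {0..t} (\<lambda>x. exp (c * x)) \<le> exp (c * t) / c" "(\<lambda>x. exp (c * x)) integrable_on {0..t}" if "t \<ge> 0" for t
    using has_integral_exp_mult[OF c that] c
    by (auto simp: integral_unique divide_right_mono integrable_on_def)
  have G_diff: "norm (G w t - G w' t) \<le> K / c * exp (c * max 0 t) * dist w w'" for w w' t
  proof -
    let ?t = "max 0 t"
    have "norm (G w t - G w' t) = norm (integral {0..?t} (\<lambda>x. f (lift w x) - f (lift w' x)))"
      unfolding G_def by (subst integral_diff[OF int int]) simp
    also have "\<dots> \<le> integral {0..?t} (\<lambda>x. K * dist w w' * exp (c * x))"
    proof (rule integral_norm_bound_integral)
      fix x
      have "norm (f (lift w x) - f (lift w' x)) \<le> K * norm (lift w x - lift w' x)" by (rule lip)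
      also have "norm (lift w x - lift w' x) = exp (c * x) * dist (w x) (w' x)"
        by (simp add: lift_def dist_norm flip: scaleR_diff_right)
      also have "K * (exp (c * x) * dist (w x) (w' x)) \<le> K * (exp (c * x) * dist w w')"
        using K by (intro mult_left_mono dist_bounded) auto
      finally show "norm (f (lift w x) - f (lift w' x)) \<le> K * dist w w' * exp (c * x)"
        by (simp add: mult_ac)
    qed (intro integrable_diff int integrable_on_mult_right exp_int; simp)+
    also have "\<dots> = K * dist w w' * integral {0..?t} (\<lambda>x. exp (c * x))" by simp
    also have "\<dots> \<le> K * dist w w' * (exp (c * ?t) / c)"
      using K by (intro mult_left_mono exp_int) auto
    finally show ?thesis by (simp add: mult_ac)
  qed
  have P_diff: "norm (P w t - P w' t) \<le> dist w w' / 2" for w w' t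
  proof -
    have "norm (P w t - P w' t) = exp (- c * max 0 t) * norm (G w t - G w' t)"
      by (simp add: P_def flip: scaleR_diff_right)
    also have "\<dots> \<le> exp (- c * max 0 t) * (K / c * exp (c * max 0 t) * dist w w')"
      by (intro mult_left_mono G_diff) auto
    also have "\<dots> = K / c * dist w w' * (exp (- c * max 0 t) * exp (c * max 0 t))" by (simp only: mult_ac)
    also have "\<dots> = dist w w' / 2" using K by (simp add: c_def flip: exp_add)
    finally show ?thesis .
  qed
  \<comment> \<open>Together with \<open>P_diff\<close> this bounds \<open>P w\<close> for every
    \<open>w\<close>, so the operator maps the space into itself.\<close>
  have P0: "norm (P 0 t) \<le> norm (f y0) / c" for t
  proof -
    have "norm (P 0 t) = exp (- c * max 0 t) * max 0 t * norm (f y0)"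
      by (simp add: P_def G_def lift_def)
    also have "exp (- c * max 0 t) * max 0 t \<le> 1 / c"
    proof -
      have "c * max 0 t \<le> exp (c * max 0 t)" using exp_ge_add_one_self[of "c * max 0 t"] by linarith
      then show ?thesis using c by (simp add: exp_minus field_simps)
    qed
    finally show ?thesis by (simp add: mult_right_mono)
  qed
  have bc: "P w \<in> bcontfun" for w
  proof (rule bcontfun_normI)
    show "continuous_on UNIV (P w)" unfolding P_def by (intro continuous_intros G_cont)
    show "norm (P w t) \<le> dist w 0 / 2 + norm (f y0) / c" for t
      using norm_triangle_sub[of "P w t" "P 0 t"] P_diff[of w t 0] P0[of t] by linarith
  qed
  have "\<exists>!w. Bcontfun (P w) = w"
  proof (rule banach_fix_type[of "1 / 2"])
    show "\<forall>w w'. dist (Bcontfun (P w)) (Bcontfun (P w')) \<le> 1 / 2 * dist w w'"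
      by (intro allI dist_bound) (use P_diff in \<open>simp add: Bcontfun_inverse[OF bc] dist_norm\<close>)
  qed auto
  then obtain w where "Bcontfun (P w) = w" by blast
  then have w: "apply_bcontfun w t = P w t" for t by (metis Bcontfun_inverse[OF bc])
  define y where "y = (\<lambda>t. y0 + integral {0..t} (\<lambda>x. f (lift w x)))"
  have y: "lift w t = y t" if "t \<ge> 0" for t
  proof -
    have "lift w t = y0 + exp (c * t) *\<^sub>R P w t" by (simp add: lift_def w[of t])
    also have "\<dots> = y t" using that by (simp add: y_def P_def G_def flip: exp_add)
    finally show ?thesis .
  qed
  show thesis
  proof
    show "y 0 = y0" by (simp add: y_def)
    fix t :: real assume t: "t \<ge> 0"
    have "((\<lambda>t. y0 + integral {0..t} (\<lambda>x. f (lift w x))) has_vector_derivative f (lift w t)) (at t within {0..})"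
      using D[OF t, of w] by (auto intro!: derivative_eq_intros)
    then have "(y has_vector_derivative f (lift w t)) (at t within {0..})"
      by (subst y_def)
    then show "(y has_vector_derivative f (y t)) (at t within {0..})"
      by (simp only: y[OF t])
  qed
qed

section \<open>Ordered flows\<close>

text \<open>\<open>Y m\<close> is the position of the \<open>m\<close>-th particle in cyclic order, unrolled over all integers \<open>m\<close>.\<close>

lemma cyclic_gap_lower_bound:
  fixes Y :: "int \<Rightarrow> real \<Rightarrow> real" and n :: int and F :: "real \<Rightarrow> real"
  assumes n: "n > 0" and F: "mono F"
    and per: "\<And>m q t. Y (m + n * q) t = Y m t + L * of_int q"
    and deriv: "\<And>m t. t \<ge> 0 \<Longrightarrow>
      (Y m has_real_derivative - (\<Sum>k\<in>{1..<n}. F (Y m t - Y (m - k) t))) (at t within {0..})"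
    and init: "\<And>m. \<delta> \<le> Y (m + 1) 0 - Y m 0"
    and t: "t \<ge> 0"
  shows "\<delta> \<le> Y (m + 1) t - Y m t"
proof (rule field_le_epsilon)
  fix e' :: real assume "e' > 0"
  \<comment> \<open>The barrier \<open>\<delta> - e * (1 + u)\<close> starts below
    \<open>\<delta>\<close> and falls with slope \<open>e\<close>, so a nonnegative derivative of a
    gap on or below it already gives a contradiction; at time \<open>t\<close> the loss is
    \<open>e'\<close>.\<close>
  define e where "e = e' / (1 + t)"
  have e: "e > 0" using \<open>e' > 0\<close> t by (simp add: e_def)
  define g where "g = (\<lambda>m t. Y (m + 1) t - Y m t)"
  have g_mod: "g m t = g (m mod n) t" for m t
  proof -
    have "m + 1 = (m mod n + 1) + n * (m div n)" "m = m mod n + n * (m div n)" by simp_all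
    then have "Y (m + 1) t = Y (m mod n + 1) t + L * of_int (m div n)"
      "Y m t = Y (m mod n) t + L * of_int (m div n)"
      by (metis per)+
    then show ?thesis by (simp add: g_def)
  qed
  have g_deriv: "(g m has_real_derivative (\<Sum>k\<in>{1..<n}. F (Y m t - Y (m - k) t)
      - F (Y (m + 1) t - Y (m + 1 - k) t))) (at t within {0..})" if "t \<ge> 0" for m t
    unfolding g_def
    by (rule DERIV_cong[OF DERIV_diff[OF deriv deriv]]) (use that in \<open>auto simp: sum_subtractf\<close>)
  have "g m t > \<delta> - e * (1 + t)"
  proof (rule ccontr)
    assume "\<not> g m t > \<delta> - e * (1 + t)"
    then have bad: "g (m mod n) t + e * t \<le> \<delta> - e" by (simp add: g_mod[of m] algebra_simps)
    \<comment> \<open>These are the times at which some gap lies on or below the barrier. By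
      periodicity finitely many gaps are involved, so \<open>B\<close> is closed and has a first
      element.\<close>
    define B where "B = (\<Union>m\<in>{0..<n}. {u \<in> {0..t}. g m u + e * u \<le> \<delta> - e})"
    have "continuous_on {0..} (g m)" for m
      unfolding continuous_on_eq_continuous_within by (auto intro!: DERIV_continuous[OF g_deriv])
    then have "continuous_on {0..t} (g m)" for m
      by (rule continuous_on_subset) auto
    then have "closed {u \<in> {0..t}. g m u + e * u \<le> \<delta> - e}" for m
      by (intro continuous_on_closed_Collect_le continuous_intros) auto
    then have "closed B" unfolding B_def by (intro closed_UN) auto
    moreover have "B \<subseteq> {0..t}" by (auto simp: B_def)
    ultimately have "compact B"
      by (metis bounded_closed_interval bounded_subset compact_eq_bounded_closed)
    moreover have "t \<in> B" using bad t n by (auto simp: B_def intro!: bexI[of _ "m mod n"])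
    ultimately obtain t0 where t0: "t0 \<in> B" "\<And>u. u \<in> B \<Longrightarrow> t0 \<le> u"
      using compact_attains_inf[of B] by blast
    then have t0_range: "0 \<le> t0" "t0 \<le> t" by (auto simp: B_def)
    obtain m0 where m0: "m0 \<in> {0..<n}" "\<And>m. m \<in> {0..<n} \<Longrightarrow> g m0 t0 \<le> g m t0"
      using ex_min_if_finite[of "(\<lambda>m. g m t0) ` {0..<n}"] n
      by (force simp: not_less)
    have m0_min: "g m0 t0 \<le> g m t0" for m
      using m0(2)[of "m mod n"] n g_mod[of m t0] by simp
    have m0_bad: "g m0 t0 + e * t0 \<le> \<delta> - e"
    proof -
      obtain m' where "m' \<in> {0..<n}" "g m' t0 + e * t0 \<le> \<delta> - e" using t0(1) by (auto simp: B_def)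
      with m0(2)[of m'] show ?thesis by linarith
    qed
    have "t0 \<noteq> 0"
    proof
      assume "t0 = 0"
      with m0_bad init[of m0] e show False by (simp add: g_def)
    qed
    with t0_range have t0_pos: "t0 > 0" by simp
    \<comment> \<open>\<open>D\<close> is the derivative of the smallest gap. The distances of its
      two ends to their \<open>k\<close>-th predecessors differ by
      \<open>g (m0 - k) t0 - g m0 t0 \<ge> 0\<close>.\<close>
    define D where "D = (\<Sum>k\<in>{1..<n}. F (Y m0 t0 - Y (m0 - k) t0) - F (Y (m0 + 1) t0 - Y (m0 + 1 - k) t0))"
    have "D \<ge> 0"
      unfolding D_def
    proof (intro sum_nonneg)
      fix k
      have "Y (m0 + 1) t0 - Y (m0 + 1 - k) t0 \<le> Y m0 t0 - Y (m0 - k) t0"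
        using m0_min[of "m0 - k"] by (simp add: g_def algebra_simps)
      then show "0 \<le> F (Y m0 t0 - Y (m0 - k) t0) - F (Y (m0 + 1) t0 - Y (m0 + 1 - k) t0)"
        using F by (simp add: monoD)
    qed
    have "(g m0 has_real_derivative D) (at t0)"
      using g_deriv[of t0 m0] t0_pos at_within_interior[of t0 "{0..}"]
      by (simp add: D_def interior_real_atLeast)
    then have "((\<lambda>u. g m0 u + e * u) has_real_derivative D + e) (at t0)"
      by (auto intro!: derivative_eq_intros)
    \<comment> \<open>The positive derivative puts this gap below the barrier shortly before
      \<open>t0\<close>, contrary to the choice of \<open>t0\<close>.\<close>
    then obtain d where d: "d > 0" "\<And>h. 0 < h \<Longrightarrow> h < d \<Longrightarrow> g m0 (t0 - h) + e * (t0 - h) < g m0 t0 + e * t0"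
      using DERIV_pos_inc_left[of "\<lambda>u. g m0 u + e * u" "D + e" t0] \<open>D \<ge> 0\<close> e by auto
    define h where "h = min (d / 2) (t0 / 2)"
    have h: "0 < h" "h < d" "h < t0" using d(1) t0_pos by (auto simp: h_def)
    then have "t0 - h \<in> B"
      using d(2)[of h] m0 m0_bad t0_range by (auto simp: B_def intro!: bexI[of _ m0])
    with t0(2) h show False by force
  qed
  moreover have "e * (1 + t) = e'" using t by (simp add: e_def)
  ultimately show "\<delta> \<le> Y (m + 1) t - Y m t + e'" by (simp add: g_def)
qed

lemma gap_le_difference:
  fixes Y :: "int \<Rightarrow> real"
  assumes gap: "\<And>m. \<delta> \<le> Y (m + 1) - Y m" and "\<delta> \<ge> 0" "m < m'"
  shows "\<delta> \<le> Y m' - Y m"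
  using \<open>m < m'\<close>
proof (induction m' rule: int_gr_induct)
  case base
  show ?case by (rule gap)
next
  case (step m')
  then show ?case using gap[of m'] \<open>\<delta> \<ge> 0\<close> by linarith
qed

text \<open>The order is taken from \<open>X0\<close> rather than from \<open>y\<close>, which makes
  the field Lipschitz everywhere when \<open>F\<close> is. It is the negative gradient of the energy
  as long as the initial order persists and the distances stay where \<open>F\<close> is the slope
  of the interaction.\<close>

definition ordered_velocity :: "(real \<Rightarrow> real) \<Rightarrow> real ^ 'n \<Rightarrow> real ^ 'n \<Rightarrow> real ^ 'n" where
  "ordered_velocity F X0 y = (\<chi> i. - (\<Sum>j\<in>UNIV - {i}.
     if X0 $ j < X0 $ i then F (y $ i - y $ j) else - F (y $ j - y $ i)))"

text \<open>Labelling the particles by their initial order and unrolling them periodically brings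
  the system into the form of \<open>cyclic_gap_lower_bound\<close>: by \<open>reflect\<close>, the
  push from a particle ahead is the push from its copy one period behind.\<close>

lemma ordered_flow_separated:
  fixes X0 :: "real ^ 'n" and y :: "real \<Rightarrow> real ^ 'n"
  assumes F: "mono F" and reflect: "\<And>r. F (L - r) = - F r"
    and inj: "inj (\<lambda>i. X0 $ i)" and \<delta>: "0 < \<delta>" "\<delta> \<le> L"
    and sep: "\<And>i j. X0 $ j < X0 $ i \<Longrightarrow> \<delta> \<le> X0 $ i - X0 $ j \<and> X0 $ i - X0 $ j \<le> L - \<delta>"
    and y0: "y 0 = X0"
    and y: "\<And>t. t \<ge> 0 \<Longrightarrow> (y has_vector_derivative ordered_velocity F X0 (y t)) (at t within {0..})"
    and t: "t \<ge> 0" and ij: "X0 $ j < X0 $ i"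
  shows "\<delta> \<le> y t $ i - y t $ j \<and> y t $ i - y t $ j \<le> L - \<delta>"
proof -
  define n where "n = int CARD('n)"
  have n: "n > 0" by (simp add: n_def)
  define h where "h = (\<lambda>k. sorted_list_of_set (range (\<lambda>i. X0 $ i)) ! k)"
  have card: "card (range (\<lambda>i. X0 $ i)) = CARD('n)" by (rule card_image[OF inj])
  then have len: "length (sorted_list_of_set (range (\<lambda>i. X0 $ i))) = CARD('n)" by simp
  have h_range: "h k \<in> range (\<lambda>i. X0 $ i)" if "k < CARD('n)" for k
    unfolding h_def using nth_mem[of k "sorted_list_of_set (range (\<lambda>i. X0 $ i))"] that len by simp
  have h_less: "h k < h l" if "k < l" "l < CARD('n)" for k l
    unfolding h_def using that len by (intro sorted_wrt_nth_less[OF strict_sorted_list_of_set]) auto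
  define \<sigma> where "\<sigma> = (\<lambda>m::int. inv (\<lambda>i. X0 $ i) (h (nat m)))"
  have X\<sigma>: "X0 $ \<sigma> m = h (nat m)" if "m \<in> {0..<n}" for m
  proof -
    have "h (nat m) \<in> range (\<lambda>i. X0 $ i)" using that by (intro h_range) (auto simp: n_def nat_less_iff)
    then show ?thesis unfolding \<sigma>_def by (rule f_inv_into_f)
  qed
  have \<sigma>_mono: "X0 $ \<sigma> a < X0 $ \<sigma> b" if "a \<in> {0..<n}" "b \<in> {0..<n}" "a < b" for a b
  proof -
    have "h (nat a) < h (nat b)" using that by (intro h_less) (auto simp: n_def nat_less_iff)
    then show ?thesis using that by (simp add: X\<sigma>)
  qed
  have \<sigma>_less_iff: "X0 $ \<sigma> a < X0 $ \<sigma> b \<longleftrightarrow> a < b" if "a \<in> {0..<n}" "b \<in> {0..<n}" for a b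
    using \<sigma>_mono[of a b] \<sigma>_mono[of b a] that by (cases a b rule: linorder_cases) auto
  have \<sigma>_inj: "inj_on \<sigma> {0..<n}"
    by (rule inj_onI) (metis \<sigma>_mono less_irrefl linorder_neqE)
  have \<sigma>_surj: "\<sigma> ` {0..<n} = UNIV"
  proof (rule card_subset_eq)
    show "card (\<sigma> ` {0..<n}) = card (UNIV :: 'n set)"
      using card_image[OF \<sigma>_inj] by (simp add: n_def)
  qed auto
  define Y where "Y = (\<lambda>m t. y t $ \<sigma> (m mod n) + L * of_int (m div n))"
  have mod: "m mod n \<in> {0..<n}" for m using n by simp
  have vel: "ordered_velocity F X0 (y t) $ \<sigma> (m mod n) = - (\<Sum>k\<in>{1..<n}. F (Y m t - Y (m - k) t))" for m t
  proof -
    let ?a = "m mod n"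
    let ?f = "\<lambda>j. if X0 $ j < X0 $ \<sigma> ?a then F (y t $ \<sigma> ?a - y t $ j) else - F (y t $ j - y t $ \<sigma> ?a)"
    have "UNIV - {\<sigma> ?a} = \<sigma> ` ({0..<n} - {?a})"
      using \<sigma>_inj \<sigma>_surj mod[of m] by (auto simp: inj_on_def)
    then have "(\<Sum>j\<in>UNIV - {\<sigma> ?a}. ?f j) = (\<Sum>b\<in>{0..<n} - {?a}. ?f (\<sigma> b))"
      using sum.reindex[OF inj_on_subset[OF \<sigma>_inj, of "{0..<n} - {?a}"], of ?f] by auto
    also have "\<dots> = (\<Sum>k\<in>{1..<n}. F (Y m t - Y (m - k) t))"
    \<comment> \<open>\<open>(m - b) mod n\<close> counts the places from the last copy of
      \<open>b\<close> up to \<open>m\<close>; the same formula is its own inverse.\<close>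
    proof (rule sum.reindex_bij_witness[where i="\<lambda>k. (m - k) mod n" and j="\<lambda>b. (m - b) mod n"])
      fix b assume b: "b \<in> {0..<n} - {?a}"
      have bm: "(m - (m - b) mod n) mod n = b" using b by (simp add: mod_diff_right_eq)
      then show "(m - (m - b) mod n) mod n = b" .
      have "(m - b) mod n \<noteq> 0"
      proof
        assume "(m - b) mod n = 0"
        with bm b show False by simp
      qed
      then show k: "(m - b) mod n \<in> {1..<n}" using mod[of "m - b"] by auto
      define k where "k = (m - b) mod n"
      have k1: "1 \<le> k" "k < n" using k by (auto simp: k_def)
      have ab: "0 \<le> ?a" "?a < n" "0 \<le> b" "b < n" using n b by auto
      have kb: "(m - k) mod n = b" using bm by (simp add: k_def)
      have dm: "m = n * (m div n) + ?a" "m - k = n * ((m - k) div n) + b"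
        using mult_div_mod_eq[of n m] mult_div_mod_eq[of n "m - k"] by (simp_all only: kb)
      have keq: "k = n * (m div n - (m - k) div n) + (?a - b)"
        using dm unfolding right_diff_distrib by linarith
      show "F (Y m t - Y (m - (m - b) mod n) t) = ?f (\<sigma> b)"
      proof (cases "b < ?a")
        case True
        \<comment> \<open>A particle earlier in the order is met within the same period.\<close>
        have "m div n - (m - k) div n = 0"
        proof -
          have "n * (m div n - (m - k) div n) < n * 1" using keq k1 True by linarith
          then have "m div n - (m - k) div n < 1" using n by (simp only: mult_less_cancel_left_pos)
          moreover have "n * (m div n - (m - k) div n) > n * (-1)"
            using keq k1 True ab by linarith
          then have "m div n - (m - k) div n > -1" using n by (simp only: mult_less_cancel_left_pos)
          ultimately show ?thesis by linarith
        qed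
        then have "Y m t - Y (m - k) t = y t $ \<sigma> ?a - y t $ \<sigma> b" by (simp add: Y_def kb)
        moreover have "X0 $ \<sigma> b < X0 $ \<sigma> ?a" using True b mod[of m] by (intro \<sigma>_mono) auto
        ultimately show ?thesis by (simp add: k_def)
      next
        case False
        with b have ba: "?a < b" by auto
        \<comment> \<open>A particle later in the order is met one period back, so that the distance
          is \<open>L\<close> minus the difference of the positions.\<close>
        have "m div n - (m - k) div n = 1"
        proof -
          have "n * (m div n - (m - k) div n) < n * 2"
            using keq k1 ab by linarith
          then have "m div n - (m - k) div n < 2" using n by (simp only: mult_less_cancel_left_pos)
          moreover have "n * (m div n - (m - k) div n) > n * 0" using keq k1 ba by linarith
          then have "m div n - (m - k) div n > 0" using n by (simp only: mult_less_cancel_left_pos)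
          ultimately show ?thesis by linarith
        qed
        then have "m div n = (m - k) div n + 1" by simp
        then have "Y m t - Y (m - k) t = L - (y t $ \<sigma> b - y t $ \<sigma> ?a)"
          by (simp add: Y_def kb algebra_simps)
        moreover have "\<not> X0 $ \<sigma> b < X0 $ \<sigma> ?a"
          using \<sigma>_less_iff[of b ?a] ba b mod[of m] by auto
        ultimately show ?thesis by (simp add: reflect k_def)
      qed
    next
      fix k assume k: "k \<in> {1..<n}"
      show "(m - (m - k) mod n) mod n = k" using k by (simp add: mod_diff_right_eq)
      moreover have "(m - k) mod n \<noteq> ?a"
      proof
        assume "(m - k) mod n = ?a"
        then have "(m - (m - k) mod n) mod n = (m - m mod n) mod n" by simp
        also have "\<dots> = 0" by (simp add: mod_diff_right_eq)
        finally show False using k by (simp add: mod_diff_right_eq)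
      qed
      ultimately show "(m - k) mod n \<in> {0..<n} - {?a}" using mod[of "m - k"] by auto
    qed
    finally show ?thesis by (simp add: ordered_velocity_def)
  qed
  have per: "Y (m + n * q) t = Y m t + L * of_int q" for m q t
    using n by (simp add: Y_def algebra_simps)
  have gap0: "\<delta> \<le> Y (m + 1) 0 - Y m 0" for m
  proof -
    define a where "a = m mod n"
    have a: "a \<in> {0..<n}" using mod by (simp add: a_def)
    have m: "m = n * (m div n) + a" by (simp add: a_def)
    have Ym: "Y m 0 = X0 $ \<sigma> a + L * of_int (m div n)" by (simp add: Y_def a_def y0)
    show ?thesis
    proof (cases "a + 1 < n")
      case True
      have m1: "m + 1 = n * (m div n) + (a + 1)" using m by linarith
      have "(n * q + (a + 1)) mod n = a + 1" "(n * q + (a + 1)) div n = q" for q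
        using True a n by simp_all
      then have "(m + 1) mod n = a + 1" "(m + 1) div n = m div n" by (metis m1)+
      then have "Y (m + 1) 0 - Y m 0 = X0 $ \<sigma> (a + 1) - X0 $ \<sigma> a"
        by (simp add: Y_def y0 flip: a_def)
      then show ?thesis using sep[OF \<sigma>_mono[of a "a + 1"]] True a by auto
    next
      case False
      with a have an: "a + 1 = n" by auto
      \<comment> \<open>The last particle is followed by the first one of the next period; the upper
        bound in \<open>sep\<close> controls this gap.\<close>
      then have "m + 1 = 0 + n * (m div n + 1)" using m by (simp add: algebra_simps)
      then have "Y (m + 1) 0 = Y 0 0 + L * of_int (m div n + 1)" by (metis per)
      then have eq: "Y (m + 1) 0 - Y m 0 = X0 $ \<sigma> 0 + L - X0 $ \<sigma> a"
        by (simp add: Ym algebra_simps) (simp add: Y_def y0)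
      show ?thesis
      \<comment> \<open>If \<open>a = 0\<close> here, there is a single particle and its gap is the
        whole period.\<close>
      proof (cases "a = 0")
        case True
        then show ?thesis using eq \<delta> by simp
      next
        case False
        then have "X0 $ \<sigma> 0 < X0 $ \<sigma> a" using a by (intro \<sigma>_mono) auto
        from sep[OF this] show ?thesis using eq by linarith
      qed
    qed
  qed
  have deriv: "(Y m has_real_derivative - (\<Sum>k\<in>{1..<n}. F (Y m t - Y (m - k) t))) (at t within {0..})"
    if "t \<ge> 0" for m t
  proof -
    have "((\<lambda>t. y t $ \<sigma> (m mod n)) has_vector_derivative ordered_velocity F X0 (y t) $ \<sigma> (m mod n)) (at t within {0..})"
      by (rule bounded_linear.has_vector_derivative[OF bounded_linear_vec_nth y[OF that]])
    then have "((\<lambda>t. y t $ \<sigma> (m mod n)) has_real_derivative ordered_velocity F X0 (y t) $ \<sigma> (m mod n)) (at t within {0..})"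
      by (simp add: has_real_derivative_iff_has_vector_derivative)
    from DERIV_add[OF this DERIV_const]
    have "(Y m has_real_derivative ordered_velocity F X0 (y t) $ \<sigma> (m mod n)) (at t within {0..})"
      unfolding Y_def by (simp only: add_0_right)
    then show ?thesis by (simp only: vel)
  qed
  have gap: "\<delta> \<le> Y (m + 1) t - Y m t" for m
    by (rule cyclic_gap_lower_bound[OF n F per deriv gap0 t])
  obtain a b where a: "a \<in> {0..<n}" "i = \<sigma> a" and b: "b \<in> {0..<n}" "j = \<sigma> b"
    using \<sigma>_surj by (metis UNIV_I imageE)
  have "b < a" using ij \<sigma>_less_iff[OF b(1) a(1)] a b by simp
  have Yab: "Y a t = y t $ i" "Y b t = y t $ j" using a b by (simp_all add: Y_def)
  \<comment> \<open>As \<open>b < a < b + n\<close>, the gaps separate \<open>a\<close> both from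
    \<open>b\<close> and from the next copy of \<open>b\<close>; the latter gives the upper
    bound.\<close>
  have "\<delta> \<le> Y a t - Y b t"
    by (rule gap_le_difference[of \<delta> "\<lambda>m. Y m t"]) (use gap \<delta> \<open>b < a\<close> in auto)
  moreover have "\<delta> \<le> Y (b + n * 1) t - Y a t"
    by (rule gap_le_difference[of \<delta> "\<lambda>m. Y m t"]) (use gap \<delta> a b in auto)
  ultimately show ?thesis unfolding per Yab by simp
qed

section \<open>The gradient flow\<close>

text \<open>The separation keeps each distance where \<open>trunc_slope\<close> is the true
  derivative of the interaction. The pair forces are antisymmetric, so the two orderings of a pair
  contribute equally and cancel the factor \<open>1 / 2\<close>.\<close>

lemma GDERIV_energy:
  fixes X0 Y :: "real ^ 'n"
  assumes s: "0 < s" "s < 1 / 2" and inj: "inj (\<lambda>i. X0 $ i)" and d: "d > 0"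
    and sep: "\<And>i j. X0 $ j < X0 $ i \<Longrightarrow> d < Y $ i - Y $ j \<and> Y $ i - Y $ j < real CARD('n) - d"
  shows "GDERIV (energy s) Y :> - ordered_velocity (trunc_slope (real CARD('n)) (1 + 2 * s) d) X0 Y"
proof -
  let ?L = "real CARD('n)" and ?p = "1 + 2 * s"
  let ?F = "trunc_slope ?L ?p d" and ?\<Phi> = "interaction ?L ?p"
  \<comment> \<open>The diagonal terms of the energy are constant, hence 0; the sign in the last
    case comes from the evenness of the interaction.\<close>
  define \<phi> where "\<phi> = (\<lambda>i j. if i = j then 0
    else if X0 $ j < X0 $ i then ?F (Y $ i - Y $ j) else - ?F (Y $ j - Y $ i))"
  have L: "?L > 0" and p: "1 < ?p" "?p < 2" using s by auto
  have cases: "X0 $ j < X0 $ i \<or> X0 $ i < X0 $ j" if "i \<noteq> j" for i j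
    using injD[OF inj, of i j] that by (metis linorder_neqE)
  have deriv: "((\<lambda>X. ?\<Phi> (X $ i - X $ j)) has_derivative (\<lambda>h. \<phi> i j * (h $ i - h $ j))) (at Y)" for i j
  proof (cases "i = j")
    case False
    have "(?\<Phi> has_real_derivative \<phi> i j) (at (Y $ i - Y $ j))"
    proof (cases "X0 $ j < X0 $ i")
      case True
      then show ?thesis
        using sep[OF True] interaction_has_derivative[OF L p d] False by (simp add: \<phi>_def)
    next
      case F: False
      then have "X0 $ i < X0 $ j" using cases[OF False] by auto
      from sep[OF this] have "(?\<Phi> has_real_derivative ?F (Y $ j - Y $ i)) (at (Y $ j - Y $ i))"
        using interaction_has_derivative[OF L p d] by blast
      then have "(?\<Phi> has_real_derivative ?F (Y $ j - Y $ i)) (at (- (Y $ i - Y $ j)))" by simp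
      then have "((\<lambda>x. ?\<Phi> (- x)) has_real_derivative - ?F (Y $ j - Y $ i)) (at (Y $ i - Y $ j))"
        by (simp only: DERIV_mirror)
      then show ?thesis using F False by (simp add: \<phi>_def)
    qed
    then have "(?\<Phi> has_derivative (\<lambda>x. \<phi> i j * x)) (at (Y $ i - Y $ j))"
      by (simp add: has_field_derivative_def)
    moreover have "((\<lambda>X. X $ i - X $ j) has_derivative (\<lambda>h. h $ i - h $ j)) (at Y)"
      by (intro has_derivative_diff bounded_linear_imp_has_derivative bounded_linear_vec_nth)
    ultimately show ?thesis by (rule has_derivative_compose[rotated])
  qed (simp add: \<phi>_def)
  have anti: "\<phi> j i = - \<phi> i j" for i j
    using cases[of i j] by (auto simp: \<phi>_def)
  have "((\<lambda>X. 1 / 2 * (\<Sum>i\<in>UNIV. \<Sum>j\<in>UNIV. ?\<Phi> (X $ i - X $ j))) has_derivative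
     (\<lambda>h. 1 / 2 * (\<Sum>i\<in>UNIV. \<Sum>j\<in>UNIV. \<phi> i j * (h $ i - h $ j)))) (at Y)"
    by (intro has_derivative_mult_right has_derivative_sum deriv)
  moreover have "energy s = (\<lambda>X::real ^ 'n. 1 / 2 * (\<Sum>i\<in>UNIV. \<Sum>j\<in>UNIV. ?\<Phi> (X $ i - X $ j)))"
    by (rule ext) (rule energy_eq_sum_interaction[OF s])
  moreover have "1 / 2 * (\<Sum>i\<in>UNIV. \<Sum>j\<in>UNIV. \<phi> i j * (h $ i - h $ j)) = h \<bullet> - ordered_velocity ?F X0 Y" for h
  proof -
    have "(\<Sum>i\<in>UNIV. \<Sum>j\<in>UNIV. \<phi> i j * h $ j) = (\<Sum>j\<in>UNIV. \<Sum>i\<in>UNIV. \<phi> i j * h $ j)"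
      by (rule sum.swap)
    also have "\<dots> = - (\<Sum>j\<in>UNIV. \<Sum>i\<in>UNIV. \<phi> j i * h $ j)"
      by (subst anti) (simp add: sum_negf)
    finally have "(\<Sum>i\<in>UNIV. \<Sum>j\<in>UNIV. \<phi> i j * (h $ i - h $ j)) = 2 * (\<Sum>i\<in>UNIV. \<Sum>j\<in>UNIV. \<phi> i j * h $ i)"
      by (simp add: right_diff_distrib sum_subtractf)
    moreover have "(- ordered_velocity ?F X0 Y) $ i = (\<Sum>j\<in>UNIV. \<phi> i j)" for i
    proof -
      have "(\<Sum>j\<in>UNIV. \<phi> i j) = (\<Sum>j\<in>UNIV - {i}. \<phi> i j)"
        by (rule sum.mono_neutral_right) (auto simp: \<phi>_def)
      also have "\<dots> = (- ordered_velocity ?F X0 Y) $ i"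
        by (auto simp: ordered_velocity_def \<phi>_def intro!: sum.cong)
      finally show ?thesis by simp
    qed
    ultimately show ?thesis
      by (simp add: inner_vec_def sum_distrib_left mult.commute)
  qed
  ultimately show ?thesis by (simp only: gderiv_def)
qed

lemma ordered_velocity_lipschitz:
  fixes X0 :: "real ^ 'n"
  assumes F: "\<And>a b. \<bar>F a - F b\<bar> \<le> C * \<bar>a - b\<bar>" and C: "C \<ge> 0"
  shows "norm (ordered_velocity F X0 x - ordered_velocity F X0 y) \<le> 2 * C * real CARD('n) ^ 2 * norm (x - y)"
proof -
  let ?v = "ordered_velocity F X0"
  have comp: "\<bar>(x - y) $ i\<bar> \<le> norm (x - y)" for i by (rule component_le_norm_cart)
  have "\<bar>(?v x - ?v y) $ i\<bar> \<le> 2 * C * real CARD('n) * norm (x - y)" for i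
  proof -
    let ?f = "\<lambda>y j. if X0 $ j < X0 $ i then F (y $ i - y $ j) else - F (y $ j - y $ i)"
    have "\<bar>(?v x - ?v y) $ i\<bar> = \<bar>\<Sum>j\<in>UNIV - {i}. ?f x j - ?f y j\<bar>"
      unfolding sum_subtractf by (simp add: ordered_velocity_def abs_minus_commute)
    also have "\<dots> \<le> (\<Sum>j\<in>UNIV - {i}. \<bar>?f x j - ?f y j\<bar>)" by (rule sum_abs)
    also have "\<dots> \<le> (\<Sum>j\<in>UNIV - {i}. C * (2 * norm (x - y)))"
    proof (rule sum_mono)
      fix j
      have "\<bar>?f x j - ?f y j\<bar> \<le> C * \<bar>(x - y) $ i - (x - y) $ j\<bar>"
        using F[of "x $ i - x $ j" "y $ i - y $ j"] F[of "x $ j - x $ i" "y $ j - y $ i"]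
        by (auto simp: abs_if algebra_simps split: if_splits)
      also have "\<dots> \<le> C * (2 * norm (x - y))"
        using comp[of i] comp[of j] C by (intro mult_left_mono) linarith+
      finally show "\<bar>?f x j - ?f y j\<bar> \<le> C * (2 * norm (x - y))" .
    qed
    also have "\<dots> \<le> (\<Sum>j\<in>(UNIV :: 'n set). C * (2 * norm (x - y)))"
      using C by (intro sum_mono2) auto
    finally show ?thesis by (simp add: mult_ac)
  qed
  then have "(\<Sum>i\<in>UNIV. \<bar>(?v x - ?v y) $ i\<bar>) \<le> (\<Sum>i\<in>(UNIV :: 'n set). 2 * C * real CARD('n) * norm (x - y))"
    by (intro sum_mono)
  then show ?thesis
    using norm_le_l1_cart[of "?v x - ?v y"] by (simp add: power2_eq_square mult_ac)
qed

lemma regular_config_separated: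
  fixes X :: "real ^ 'n"
  assumes "X \<in> regular_configs"
  obtains \<delta> where "0 < \<delta>" "\<delta> \<le> real CARD('n)"
    "\<And>i j. X $ j < X $ i \<Longrightarrow> \<delta> \<le> X $ i - X $ j \<and> X $ i - X $ j \<le> real CARD('n) - \<delta>"
proof -
  let ?L = "real CARD('n)"
  define P where "P = {(i, j). X $ j < X $ i}"
  \<comment> \<open>The complements are distances across the end of the period. Inserting
    \<open>?L\<close> keeps the set nonempty for a single particle and yields
    \<open>Min S \<le> ?L\<close>.\<close>
  define S where "S = insert ?L ((\<lambda>(i, j). X $ i - X $ j) ` P \<union> (\<lambda>(i, j). ?L - (X $ i - X $ j)) ` P)"
  have fin: "finite S" by (simp add: S_def P_def)
  have X: "0 \<le> X $ i" "X $ i < ?L" for i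
    using assms by (auto simp: regular_configs_def config_space_def)
  have pos: "x > 0" if "x \<in> S" for x
  proof -
    have "0 < ?L - (X $ i - X $ j)" for i j using X(1)[of j] X(2)[of i] by linarith
    with that show ?thesis by (auto simp: S_def P_def)
  qed
  have le: "Min S \<le> x" if "x \<in> S" for x using fin that by simp
  have ne: "S \<noteq> {}" by (simp add: S_def)
  show thesis
  proof (rule that[of "Min S"])
    show "0 < Min S" using pos Min_in[OF fin ne] by simp
    show "Min S \<le> ?L" by (rule le) (simp add: S_def)
    fix i j assume "X $ j < X $ i"
    then have "X $ i - X $ j \<in> S" "?L - (X $ i - X $ j) \<in> S"
      by (force simp: S_def P_def)+
    from this[THEN le] show "Min S \<le> X $ i - X $ j \<and> X $ i - X $ j \<le> ?L - Min S" by linarith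
  qed
qed

lemma flow_solution_infinity:
  fixes X0 :: "real ^ 'n"
  assumes s: "0 < s" "s < 1 / 2" and X0: "X0 \<in> regular_configs"
  shows "\<exists>X. flow_solution s X0 \<infinity> X"
proof -
  let ?L = "real CARD('n)" and ?p = "1 + 2 * s"
  have L: "?L > 0" and p: "1 < ?p" using s by auto
  have inj: "inj (\<lambda>i. X0 $ i)" using X0 by (simp add: regular_configs_def)
  obtain \<delta> where \<delta>: "0 < \<delta>" "\<delta> \<le> ?L"
    and sep: "\<And>i j. X0 $ j < X0 $ i \<Longrightarrow> \<delta> \<le> X0 $ i - X0 $ j \<and> X0 $ i - X0 $ j \<le> ?L - \<delta>"
    using regular_config_separated[OF X0] by blast
  \<comment> \<open>The derivative formula needs distances strictly between \<open>d\<close> and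
    \<open>?L - d\<close>, while the flow only guarantees the closed bounds with
    \<open>\<delta>\<close>.\<close>
  define d where "d = \<delta> / 2"
  have d: "0 < d" "d < \<delta>" using \<delta> by (auto simp: d_def)
  let ?F = "trunc_slope ?L ?p d"
  let ?v = "ordered_velocity ?F X0"
  obtain C where C: "\<And>a b. \<bar>?F a - ?F b\<bar> \<le> C * \<bar>a - b\<bar>"
    using trunc_slope_lipschitz[OF L d(1) p] by blast
  have "C \<ge> 0" using C[of 1 0] by simp
  \<comment> \<open>\<open>C\<close> may be 0, and the existence theorem asks for a positive
    constant; hence \<open>+ 1\<close>.\<close>
  have lip: "norm (?v x - ?v y) \<le> (2 * C * ?L\<^sup>2 + 1) * norm (x - y)" for x y
    using ordered_velocity_lipschitz[OF C \<open>C \<ge> 0\<close>, of X0 x y] norm_ge_zero[of "x - y"]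
    unfolding distrib_right by linarith
  have "2 * C * ?L\<^sup>2 + 1 > 0" using \<open>C \<ge> 0\<close> by (intro add_nonneg_pos) auto
  from lipschitz_ode_global_solution[OF lip this, of X0]
  obtain y where y0: "y 0 = X0"
    and y: "\<And>t. t \<ge> 0 \<Longrightarrow> (y has_vector_derivative ?v (y t)) (at t within {0..})" by blast
  have y_sep: "\<delta> \<le> y t $ i - y t $ j \<and> y t $ i - y t $ j \<le> ?L - \<delta>" if "t \<ge> 0" "X0 $ j < X0 $ i" for t i j
  proof (rule ordered_flow_separated[OF _ _ inj \<delta> sep y0 y that])
    show "mono ?F" using trunc_slope_mono[OF L d(1) p] by (intro monoI) auto
    show "?F (?L - r) = - ?F r" for r by (rule trunc_slope_reflect[OF L])
  qed
  have regular: "wrap (y t) \<in> regular_configs" if t: "t \<ge> 0" for t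
  proof -
    \<comment> \<open>Differences between \<open>\<delta>\<close> and \<open>?L - \<delta>\<close>
      are not multiples of the period, so wrapping keeps the particles distinct.\<close>
    have neq: "y t $ i rmod ?L \<noteq> y t $ j rmod ?L" if "X0 $ j < X0 $ i" for i j
    proof
      assume "y t $ i rmod ?L = y t $ j rmod ?L"
      then have "(y t $ i - y t $ j) rmod ?L = 0" using rmod_diff[of "y t $ i" ?L "y t $ j"] by simp
      moreover have "y t $ i - y t $ j \<in> {0..<\<bar>?L\<bar>}" using y_sep[OF t that] \<delta> by auto
      ultimately show False using y_sep[OF t that] \<delta> by simp
    qed
    have "inj (\<lambda>i. wrap (y t) $ i)"
    proof (rule injI, rule ccontr)
      fix i j assume eq: "wrap (y t) $ i = wrap (y t) $ j" and "i \<noteq> j"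
      then have "X0 $ j < X0 $ i \<or> X0 $ i < X0 $ j" using injD[OF inj, of i j] by (metis linorder_neqE)
      with neq[of i j] neq[of j i] eq show False by (auto simp: wrap_def)
    qed
    moreover have "0 \<le> wrap (y t) $ i \<and> wrap (y t) $ i < ?L" for i
      by (simp add: wrap_def rmod_nonneg rmod_less)
    ultimately show ?thesis by (simp add: regular_configs_def config_space_def)
  qed
  have "wrap X0 = X0"
    using X0 by (simp add: vec_eq_iff wrap_def regular_configs_def config_space_def)
  moreover have "continuous_on {0..} (\<lambda>t. - ?v (y t))"
  proof -
    have "(2 * C * ?L\<^sup>2 + 1)-lipschitz_on UNIV ?v"
      using lip \<open>2 * C * ?L\<^sup>2 + 1 > 0\<close> by (intro lipschitz_onI) (simp_all add: dist_norm)
    then have "continuous_on UNIV ?v" by (rule lipschitz_on_continuous_on)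
    moreover have "continuous_on {0..} y"
      unfolding continuous_on_eq_continuous_within
      by (auto intro!: has_vector_derivative_continuous[OF y])
    ultimately have "continuous_on {0..} (\<lambda>t. ?v (y t))"
      by (rule continuous_on_compose2) simp
    then show ?thesis by (rule continuous_on_minus)
  qed
  moreover have "GDERIV (energy s) (y t) :> - ?v (y t)" if "t \<ge> 0" for t
  proof (rule GDERIV_energy[OF s inj d(1)])
    fix i j assume "X0 $ j < X0 $ i"
    from y_sep[OF \<open>t \<ge> 0\<close> this] d show "d < y t $ i - y t $ j \<and> y t $ i - y t $ j < ?L - d" by linarith
  qed
  moreover have I: "{t. 0 \<le> t \<and> ereal t < \<infinity>} = {0..}" by auto
  ultimately have E: "\<exists>G. (\<forall>t\<in>{0..}. wrap (y t) = wrap (y t)) \<and> continuous_on {0..} G \<and>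
      (\<forall>t\<in>{0..}. GDERIV (energy s) (y t) :> G t \<and> (y has_vector_derivative - G t) (at t within {0..}))"
    using y by (intro exI[of _ "\<lambda>t. - ?v (y t)"]) simp
  have "wrap (y 0) = X0" using \<open>wrap X0 = X0\<close> y0 by simp
  moreover have "\<forall>t\<in>{0..}. wrap (y t) \<in> regular_configs" using regular by simp
  ultimately have "flow_solution s X0 \<infinity> (\<lambda>t. wrap (y t))"
    unfolding flow_solution_def Let_def I by (intro conjI) (assumption | rule exI[of _ y] E)+
  then show ?thesis by blast
qed

theorem proposition4p1:
  fixes s :: real and X0 :: "real ^ 'n"
  assumes "0 < s" and "s < 1 / 2"
    and "X0 \<in> regular_configs"
  shows "max_existence_time s X0 = \<infinity>"
proof -
  have "\<infinity> \<in> {T. 0 < T \<and> (\<exists>X. flow_solution s X0 T X)}"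
    using flow_solution_infinity[OF assms] by simp
  then have "\<infinity> \<le> max_existence_time s X0"
    unfolding max_existence_time_def by (rule Sup_upper)
  then show ?thesis by simp
qed

end
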